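(* A nonempty subset of $\binom{[n]}{k}$ is an arrangement of largest minors in $Gr^+(k,n)$ if and only if it is a sorted subset. Maximal arrangements of largest minors contain exactly $n$ elements. The number of maximal arrangements of largest minors in $Gr^+(k,n)$ equals the Eulerian number $A(n-1,k-1)$.
   Context: $[n]=\{1,\dots,n\}$ and $\binom{[n]}{k}$ is the set of $k$-element subsets of $[n]$. For $n\ge k\ge 0$, the Grassmannian $Gr(k,n)$ over $\mathbb{R}$ is the space of $k$-dimensional linear subspaces of $\mathbb{R}^n$, identified with real $k\times n$ matrices of rank $k$ modulo row operations. For $I\in\binom{[n]}{k}$, the Plücker coordinate $\Delta_I$ is the maximal ($k\times k$) minor in the column set $I$; the $\Delta_I$ are projective coordinates on $Gr(k,n)$ (defined up to a common nonzero factor). The positive Grassmannian $Gr^+(k,n)$ is the set of points of $Gr(k,n)$ all of whose Plücker coordinates are simultaneously positive, $\Delta_I>0$ for all $I$ (strictly speaking, all $\Delta_I$ are nonzero and have the same sign, and one chooses a representative for which they are positive). A nonempty subset $\mathcal{J}\subset\binom{[n]}{k}$ is an arrangement of largest minors in $Gr^+(k,n)$ if there is a point of $Gr^+(k,n)$ at which all $\Delta_I$, $I\in\mathcal{J}$, are equal to each other and $\Delta_K<\Delta_I$ for all $I\in\mathcal{J}$ and $K\in\binom{[n]}{k}\setminus\mathcal{J}$. Maximal means maximal by containment. Two sets $I,J\in\binom{[n]}{k}$ are sorted if their set-theoretic differences $I\setminus J=\{a_1,\dots,a_r\}$ and $J\setminus I=\{b_1,\dots,b_r\}$ are interlaced,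 i.e., $a_1<b_1<a_2<b_2<\dots<a_r<b_r$ or the same inequalities with the $a$'s and $b$'s switched. A subset of $\binom{[n]}{k}$ is sorted if every two elements in it are sorted. The Eulerian number $A(n-1,k-1)$ is the number of permutations $w$ of size $n-1$ with exactly $k-1$ descents, where a descent is an index $i$ with $w(i)>w(i+1)$.
   Formalization: The claim of exactly n elements is stated for 0<k<n or n=1, and the Eulerian count for 0<k<n or n=k=1; in the excluded cases k=0 or k=n there is only one k-subset, so these claims fail or are undefined (e.g. k=n=2: one element, A(1,1)=0). *)

theory Defs
  imports
    "Jordan_Normal_Form.DL_Rank_Submatrix"
    "HOL-Library.Ramsey"
    "HOL-Combinatorics.Permutations"
begin

text \<open>
  The \<open>k\<close>-element subsets of \<open>{1..n}\<close> are \<open>nsets {1..n} k\<close>.  Points of the Grassmannian are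
  classes of real \<open>k \<times> n\<close> matrices of rank \<open>k\<close> modulo row operations, i.e. modulo left
  multiplication by invertible \<open>k \<times> k\<close> matrices.
\<close>

definition full_rank_mats :: "nat \<Rightarrow> nat \<Rightarrow> real mat set" where
  "full_rank_mats k n = {A \<in> carrier_mat k n. vec_space.rank k A = k}"

definition row_equivalence :: "nat \<Rightarrow> nat \<Rightarrow> (real mat \<times> real mat) set" where
  "row_equivalence k n =
     {(A, B). A \<in> full_rank_mats k n \<and> B \<in> full_rank_mats k n \<and>
              (\<exists>P \<in> carrier_mat k k. invertible_mat P \<and> B = P * A)}"

definition Gr :: "nat \<Rightarrow> nat \<Rightarrow> real mat set set" where
  "Gr k n = full_rank_mats k n // row_equivalence k n"

text \<open>
  Matrix columns are indexed from 0, so the element \<open>i \<in> {1..n}\<close> refers to column \<open>i - 1\<close>.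
\<close>

definition plucker :: "real mat \<Rightarrow> nat set \<Rightarrow> real" where
  "plucker A I = det (submatrix A UNIV ((\<lambda>i. i - 1) ` I))"

text \<open>
  Plucker coordinates are defined up to a common nonzero factor: they are those of a
  representing matrix.  A point is positive if some representative has all of them positive.
\<close>

definition positive_reps :: "nat \<Rightarrow> nat \<Rightarrow> real mat set \<Rightarrow> real mat set" where
  "positive_reps k n p = {A \<in> p. \<forall>I \<in> nsets {1..n} k. plucker A I > 0}"

definition Gr_pos :: "nat \<Rightarrow> nat \<Rightarrow> real mat set set" where
  "Gr_pos k n = {p \<in> Gr k n. positive_reps k n p \<noteq> {}}"

definition largest_minors_arrangement :: "nat \<Rightarrow> nat \<Rightarrow> nat set set \<Rightarrow> bool" where
  "largest_minors_arrangement k n \<J> \<longleftrightarrow>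
     \<J> \<noteq> {} \<and> \<J> \<subseteq> nsets {1..n} k \<and>
     (\<exists>p \<in> Gr_pos k n. \<exists>A \<in> positive_reps k n p.
        (\<forall>I \<in> \<J>. \<forall>J \<in> \<J>. plucker A I = plucker A J) \<and>
        (\<forall>I \<in> \<J>. \<forall>K \<in> nsets {1..n} k - \<J>. plucker A K < plucker A I))"

definition maximal_largest_minors_arrangement :: "nat \<Rightarrow> nat \<Rightarrow> nat set set \<Rightarrow> bool" where
  "maximal_largest_minors_arrangement k n \<J> \<longleftrightarrow>
     largest_minors_arrangement k n \<J> \<and>
     (\<forall>\<J>'. largest_minors_arrangement k n \<J>' \<and> \<J> \<subseteq> \<J>' \<longrightarrow> \<J>' = \<J>)"

text \<open>
  For lists of equal length, \<open>splice [a1, a2, \<dots>] [b1, b2, \<dots>] = [a1, b1, a2, b2, \<dots>]\<close>.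
\<close>

definition interlaced :: "nat set \<Rightarrow> nat set \<Rightarrow> bool" where
  "interlaced S T \<longleftrightarrow>
     card S = card T \<and> sorted_wrt (<) (splice (sorted_list_of_set S) (sorted_list_of_set T))"

definition sorted_sets :: "nat set \<Rightarrow> nat set \<Rightarrow> bool" where
  "sorted_sets I J \<longleftrightarrow> interlaced (I - J) (J - I) \<or> interlaced (J - I) (I - J)"

definition sorted_family :: "nat set set \<Rightarrow> bool" where
  "sorted_family \<J> \<longleftrightarrow> (\<forall>I \<in> \<J>. \<forall>J \<in> \<J>. sorted_sets I J)"

definition descents :: "nat \<Rightarrow> (nat \<Rightarrow> nat) \<Rightarrow> nat set" where
  "descents m w = {i \<in> {1..<m}. w i > w (i + 1)}"

definition eulerian_number :: "nat \<Rightarrow> nat \<Rightarrow> nat" where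
  "eulerian_number m d = card {w. w permutes {1..m} \<and> card (descents m w) = d}"

end

theory Submission
  imports Defs
begin

text \<open>
  Put \<open>f I = ln \<Delta>\<^sub>I\<close> on the \<open>k\<close>-subsets of \<open>{1..n}\<close>.  Everything rests on reading a
  \<open>k\<close>-subset as a lattice path, that is as the function \<open>x \<mapsto> \<bar>I \<inter> {1..x}\<bar>\<close>, which grows by 0 or 1
  in each step.  Two sets are sorted exactly when the difference of their paths oscillates by at
  most 1, i.e. takes values in \<open>{0, 1}\<close> or in \<open>{-1, 0}\<close> (\<open>sorted_sets_iff_oscillation\<close>).

  Largest minors are sorted.  At a positive point the three-term Plucker relation says that
  \<open>\<Delta>\<^sub>S\<^sub>a\<^sub>c \<Delta>\<^sub>S\<^sub>b\<^sub>d\<close> exceeds both \<open>\<Delta>\<^sub>S\<^sub>a\<^sub>b \<Delta>\<^sub>S\<^sub>c\<^sub>d\<close> and \<open>\<Delta>\<^sub>S\<^sub>a\<^sub>d \<Delta>\<^sub>S\<^sub>b\<^sub>c\<close> for \<open>a < b < c < d\<close>.  This is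
  supermodularity of \<open>f\<close> on the smallest squares of the distributive lattice of paths, and such
  local inequalities add up to \<open>f p + f q < f (min p q) + f (max p q)\<close> for incomparable paths
  (\<open>incomparable_supermodular\<close>).  The relation is invariant under cyclic rotation of \<open>{1..n}\<close>, so
  the paths may be extended quasi-periodically to the integers and one of them may be shifted
  vertically.  If the difference of the paths of \<open>I\<close> and \<open>J\<close> oscillates by 2 or more, a suitable
  shift makes the paths cross, and then \<open>I\<close> and \<open>J\<close> cannot both maximise \<open>f\<close>
  (\<open>maximizers_sorted\<close>).

  Sorted sets are largest minors.  A Vandermonde matrix with nodes \<open>1, \<dots>, n\<close> whose column \<open>i\<close> is
  scaled by \<open>exp (t i)\<close> gives \<open>f K\<close> as the sum of all \<open>t i\<close> plus the sum of all
  \<open>ln (j - i)\<close> with \<open>i < j\<close>, where \<open>i\<close> and \<open>j\<close> run over \<open>K\<close>.  Since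
  \<open>ln (j - i)\<close> is a constant minus a positive combination of the indicators \<open>a < i < j \<le> b\<close>, the
  second sum is a constant minus a positive combination of \<open>\<bar>K \<inter> (a,b]\<bar> choose 2\<close>.  The linear term
  can turn each of these convex quadratics into one that is nonnegative on the integers and
  vanishes precisely on the one or two values that \<open>\<bar>I \<inter> (a,b]\<bar>\<close> takes for \<open>I\<close> in the given sorted
  family.  A set \<open>K\<close> for which all of them vanish belongs to the family
  (\<open>sorted_family_interval_closed\<close>), so the family is exactly the set of maximisers
  (\<open>sorted_family_selected_by_scaling\<close>).

  Counting.  The paths of a sorted family form a chain between some path and its translate by
  \<open>-1\<close>, so their areas are distinct and lie in an interval of \<open>n\<close> integers.  In a maximal family no
  area is skipped, because between any two comparable paths a single point can be raised
  (\<open>bump_between\<close>).  Hence a maximal family has \<open>n\<close> members, and it is recorded by the order in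
  which the \<open>n - 1\<close> inner points of the path drop by 1.  This order is a permutation of
  \<open>{1..n - 1}\<close>, and the top set consists of 1 and the positions following a descent, so that
  having \<open>k\<close> elements means having \<open>k - 1\<close> descents.
\<close>

section \<open>Minors and the three-term Plucker relation\<close>

text \<open>
  Minors along an arbitrary list of columns, listed from 1.  Unlike a set, a list can be permuted,
  which makes signs a matter of counting adjacent swaps.
\<close>
definition list_minor :: "'a::idom mat \<Rightarrow> nat list \<Rightarrow> 'a" where
  "list_minor A xs = det (mat (length xs) (length xs) (\<lambda>(r, c). A $$ (r, xs ! c - 1)))"

lemma list_minor_swap_adjacent:
  "list_minor A (xs @ u # v # ys) = - list_minor A (xs @ v # u # ys)"
proof -
  let ?M = "\<lambda>zs. mat (length zs) (length zs) (\<lambda>(r, c). A $$ (r, zs ! c - 1))"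
  let ?k = "length (xs @ v # u # ys)"
  have "?M (xs @ u # v # ys) = swapcols (length xs) (Suc (length xs)) (?M (xs @ v # u # ys))"
    by (rule eq_matI) (auto simp: nth_append nth_Cons' less_Suc_eq_le)
  then show ?thesis
    unfolding list_minor_def
    using det_swapcols[of "length xs" ?k "Suc (length xs)" "?M (xs @ v # u # ys)"] by simp
qed

lemma list_minor_move_right:
  "list_minor A (ys @ u # xs @ zs) = (-1) ^ length xs * list_minor A (ys @ xs @ u # zs)"
proof (induction xs arbitrary: ys)
  case (Cons x xs)
  have "list_minor A (ys @ u # (x # xs) @ zs) = - list_minor A ((ys @ [x]) @ u # xs @ zs)"
    using list_minor_swap_adjacent[of A ys u x "xs @ zs"] by simp
  also have "\<dots> = - ((-1) ^ length xs * list_minor A ((ys @ [x]) @ xs @ u # zs))"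
    by (simp only: Cons.IH)
  finally show ?case by simp
qed simp

text \<open>
  Sorting a new column into its place passes the larger columns only, each at the price of a sign.
\<close>
lemma list_minor_insort:
  assumes "sorted xs" "u \<notin> set xs"
  shows "list_minor A (ys @ insort u xs @ zs) =
         (-1) ^ length (filter (\<lambda>x. u < x) xs) * list_minor A (ys @ xs @ u # zs)"
  using assms
proof (induction xs arbitrary: ys)
  case (Cons x xs)
  show ?case
  proof (cases "u \<le> x")
    case True
    then have all: "filter (\<lambda>y. u < y) (x # xs) = x # xs"
      using Cons.prems by (auto simp: filter_id_conv) 
    show ?thesis unfolding all using True list_minor_move_right[of A ys u "x # xs" zs] by simp
  next
    case False
    have "list_minor A ((ys @ [x]) @ insort u xs @ zs) =
         (-1) ^ length (filter (\<lambda>x. u < x) xs) * list_minor A ((ys @ [x]) @ xs @ u # zs)"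
      by (rule Cons.IH) (use Cons.prems in auto)
    then show ?thesis using False by simp
  qed
qed simp

lemma bij_betw_nth_less:
  fixes xs :: "'a::linorder list"
  assumes srt: "sorted_wrt (<) xs" and c: "c < length xs"
  shows "bij_betw ((!) xs) {..<c} {a \<in> set xs. a < xs ! c}"
proof (rule bij_betw_imageI)
  show "inj_on ((!) xs) {..<c}"
    using srt c by (auto simp: strict_sorted_iff inj_on_def nth_eq_iff_index_eq)
  show "(!) xs ` {..<c} = {a \<in> set xs. a < xs ! c}"
  proof (intro equalityI subsetI)
    fix a assume "a \<in> {a \<in> set xs. a < xs ! c}"
    then obtain d where d: "d < length xs" "a = xs ! d" "xs ! d < xs ! c"
      by (auto simp: in_set_conv_nth)
    have "d < c"
      using d sorted_wrt_nth_less[OF srt, of c d] by (cases c d rule: linorder_cases) auto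
    then show "a \<in> (!) xs ` {..<c}" using d by auto
  qed (use sorted_wrt_nth_less[OF srt] c in auto)
qed

text \<open>
  The selector \<open>pick\<close> underlying submatrices enumerates a set increasingly; this is seen by
  counting the elements below a given one.
\<close>
lemma plucker_eq_list_minor:
  assumes A: "A \<in> carrier_mat k n" and I: "I \<in> nsets {1..n} k"
  shows "plucker A I = list_minor A (sorted_list_of_set I)"
proof -
  define xs where "xs = sorted_list_of_set I"
  have fin: "finite I" and card: "card I = k" and sub: "I \<subseteq> {1..n}"
    using I by (auto simp: nsets_def)
  have len: "length xs = k" and set: "set xs = I" and srt: "sorted_wrt (<) xs"
    using fin card unfolding xs_def by auto
  let ?J = "(\<lambda>i. i - 1) ` I"
  have pos: "1 \<le> i" "i \<le> n" if "i \<in> I" for i using that sub by auto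
  have inj: "inj_on (\<lambda>i. i - 1) I" using pos by (auto simp: inj_on_def dest: eq_diff_iff)
  have subJ: "{j. j < dim_col A \<and> j \<in> ?J} = ?J"
    using A pos by (auto simp: Suc_le_eq intro: less_le_trans[OF diff_less])
  have cardJ: "card ?J = k"
    using card card_image[OF inj] by simp
  have pick: "pick ?J c = xs ! c - 1" if c: "c < k" for c
  proof -
    let ?j = "xs ! c - 1"
    have mem: "xs ! c \<in> I" using c len set nth_mem by blast
    have "{a \<in> ?J. a < ?j} = (\<lambda>i. i - 1) ` {a \<in> I. a < xs ! c}"
      using pos mem by (auto simp: less_diff_iff diff_less_mono)
    also have "card \<dots> = card {a \<in> I. a < xs ! c}"
      by (rule card_image, rule inj_on_subset[OF inj]) simp
    also have "\<dots> = c"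
      using bij_betw_same_card[OF bij_betw_nth_less[OF srt, of c]] c len set by simp
    finally have "card {a \<in> ?J. a < ?j} = c" .
    then show ?thesis using pick_card_in_set[of ?j ?J] mem by auto
  qed
  have "submatrix A UNIV ?J = mat k k (\<lambda>(r, c). A $$ (r, xs ! c - 1))"
    by (rule eq_matI) (use A cardJ pick subJ in \<open>auto simp: submatrix_def pick_UNIV\<close>)
  then show ?thesis unfolding plucker_def list_minor_def xs_def[symmetric] len by simp
qed

lemma det_mat_2:
  fixes f :: "nat \<times> nat \<Rightarrow> 'a::comm_ring_1"
  shows "det (mat 2 2 f) = f (0, 0) * f (1, 1) - f (0, 1) * f (1, 0)"
proof -
  have "det (mat 2 2 f) = (\<Sum>i<2. mat 2 2 f $$ (i, 0) * cofactor (mat 2 2 f) i 0)"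
    by (rule laplace_expansion_column) auto
  also have "\<dots> = f (0, 0) * f (1, 1) - f (0, 1) * f (1, 0)"
    by (simp add: numeral_2_eq_2 cofactor_def mat_delete_def det_single lessThan_Suc)
  finally show ?thesis .
qed

text \<open>
  With all but the last two columns fixed, a minor is a \<open>2 \<times> 2\<close> determinant in two coordinates of
  the last columns.  Indeed, if the columns \<open>xs @ [a, b]\<close> form an invertible matrix, its inverse
  sends them to the standard basis, and the transformed minor becomes block triangular with
  a \<open>2 \<times> 2\<close> block at the lower right.
\<close>
lemma list_minor_last_two:
  fixes A :: "'a::field mat"
  assumes A: "A \<in> carrier_mat (length xs + 2) n"
    and nz: "list_minor A (xs @ [a, b]) \<noteq> 0"
  obtains x y \<delta> where
    "\<And>u v. list_minor A (xs @ [u, v]) = \<delta> * (x u * y v - x v * y u)"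
proof -
  define m where "m = length xs"
  define M where "M = (\<lambda>u v. mat (m + 2) (m + 2) (\<lambda>(r, c). A $$ (r, (xs @ [u, v]) ! c - 1)))"
  have carrier: "M u v \<in> carrier_mat (m + 2) (m + 2)" for u v by (simp add: M_def)
  have minor: "list_minor A (xs @ [u, v]) = det (M u v)" for u v
    by (simp add: list_minor_def M_def m_def)
  \<comment> \<open>Here \<open>Q\<close> is the inverse of the matrix with columns \<open>xs @ [a, b]\<close>, and
    \<open>w r u\<close> is coordinate \<open>r\<close> of the transformed column \<open>u\<close>.\<close>
  have "M a b \<in> Units (ring_mat TYPE('a) (m + 2) ())"
    using det_non_zero_imp_unit[OF carrier] nz minor by metis
  then obtain Q where Q: "Q \<in> carrier_mat (m + 2) (m + 2)" "Q * M a b = 1\<^sub>m (m + 2)"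
    unfolding Units_def by (auto simp: ring_mat_def)
  define w where "w = (\<lambda>r u. \<Sum>i = 0..<m + 2. Q $$ (r, i) * A $$ (i, u - 1))"
  have entry: "(Q * M u v) $$ (r, c) = w r ((xs @ [u, v]) ! c)"
    if "r < m + 2" "c < m + 2" for u v r c
    using that Q(1) unfolding w_def M_def
    by (simp add: scalar_prod_def)
  have unit: "w r ((xs @ [u, v]) ! c) = (if r = c then 1 else 0)"
    if "r < m + 2" "c < m" for u v r c
    using entry[of r c a b] that Q(2) by (simp add: m_def nth_append)
  have "det (Q * M u v) = w m u * w (m + 1) v - w m v * w (m + 1) u" for u v
  proof -
    have "Q * M u v = four_block_mat (1\<^sub>m m) (mat m 2 (\<lambda>(r, c). w r ([u, v] ! c))) (0\<^sub>m 2 m)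
        (mat 2 2 (\<lambda>(r, c). w (m + r) ([u, v] ! c)))" (is "_ = ?F")
    proof (rule eq_matI)
      fix r c assume "r < dim_row ?F" "c < dim_col ?F"
      then have rc: "r < m + 2" "c < m + 2" by auto
      show "(Q * M u v) $$ (r, c) = ?F $$ (r, c)"
        unfolding entry[OF rc] using rc unit[of r c u v]
        by (cases "c < m") (auto simp: m_def nth_append)
    qed (use Q(1) carrier[of u v] in auto)
    also have "det \<dots> = det (1\<^sub>m m) * det (mat 2 2 (\<lambda>(r, c). w (m + r) ([u, v] ! c)))"
      by (rule det_four_block_mat_lower_left_zero) auto
    finally show ?thesis by (simp add: det_mat_2)
  qed
  moreover have "det (Q * M u v) = det Q * det (M u v)" for u v
    by (rule det_mult[OF Q(1) carrier])
  moreover have "det Q * det (M a b) = 1"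
    using det_mult[OF Q(1) carrier, of a b] Q(2) by simp
  ultimately have "list_minor A (xs @ [u, v]) =
      det (M a b) * (w m u * w (m + 1) v - w m v * w (m + 1) u)" for u v
    unfolding minor by (metis mult.assoc mult.commute mult_1)
  then show thesis by (rule that)
qed

text \<open>
  The sign that relates the increasing order of the columns to the order \<open>S, u, v\<close> is a product of
  a contribution of \<open>u\<close> and one of \<open>v\<close>.  Therefore all products \<open>\<Delta>\<^sub>S\<^sub>u\<^sub>v \<Delta>\<^sub>S\<^sub>x\<^sub>y\<close> with
  \<open>{u, v, x, y}\<close> fixed get the same sign.
\<close>
lemma plucker_insert_two:
  assumes A: "A \<in> carrier_mat k n" and I: "insert u (insert v S) \<in> nsets {1..n} k"
    and uv: "u < v" "u \<notin> S" "v \<notin> S"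
  defines "\<epsilon> \<equiv> \<lambda>x. (-1) ^ card {s \<in> S. x < s} :: real"
  shows "plucker A (insert u (insert v S)) =
         \<epsilon> u * \<epsilon> v * list_minor A (sorted_list_of_set S @ [u, v])"
proof -
  define xs where "xs = sorted_list_of_set S"
  have fin: "finite S" using I by (auto simp: nsets_def)
  have xs: "sorted xs" "set xs = S" "distinct xs" using fin by (auto simp: xs_def)
  have len: "length (filter (\<lambda>x. z < x) xs) = card {s \<in> S. z < s}" for z
    using distinct_card[of "filter (\<lambda>x. z < x) xs"] xs by simp
  have lst: "sorted_list_of_set (insert u (insert v S)) = insort u (insort v xs)"
    using fin uv by (simp add: xs_def)
  have "filter (\<lambda>x. u < x) (insort v xs) = insort v (filter (\<lambda>x. u < x) xs)"
    using uv(1) by (simp add: filter_insort xs)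
  then have len': "length (filter (\<lambda>x. u < x) (insort v xs)) = Suc (card {s \<in> S. u < s})"
    by (simp add: len)
  have "plucker A (insert u (insert v S)) = list_minor A ([] @ insort u (insort v xs) @ [])"
    using plucker_eq_list_minor[OF A I] lst by simp
  also have "\<dots> = - \<epsilon> u * list_minor A ([] @ insort v xs @ [u])"
    by (subst list_minor_insort) (use uv xs len' in \<open>auto simp: sorted_insort \<epsilon>_def set_insort_key\<close>)
  also have "list_minor A ([] @ insort v xs @ [u]) = \<epsilon> v * list_minor A (xs @ [v, u])"
    by (subst list_minor_insort) (use uv xs len in \<open>auto simp: \<epsilon>_def\<close>)
  also have "list_minor A (xs @ [v, u]) = - list_minor A (xs @ [u, v])"
    using list_minor_swap_adjacent[of A xs v u "[]"] by simp
  finally show ?thesis by (simp add: xs_def)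
qed

text \<open>
  After cancelling the common sign this is the classical identity
  \<open>[ac][bd] = [ab][cd] + [ad][bc]\<close> between \<open>2 \<times> 2\<close> minors.  The nonvanishing minor supplies the
  coordinates in which the minors are \<open>2 \<times> 2\<close> determinants.
\<close>
lemma three_term_plucker_relation:
  assumes A: "A \<in> carrier_mat k n"
    and abcd: "a < b" "b < c" "c < d" "{a, b, c, d} \<inter> S = {}"
    and I: "insert a (insert b S) \<in> nsets {1..n} k" "c \<in> {1..n}" "d \<in> {1..n}"
    and nz: "plucker A (insert a (insert b S)) \<noteq> 0"
  shows "plucker A (insert a (insert c S)) * plucker A (insert b (insert d S)) =
         plucker A (insert a (insert b S)) * plucker A (insert c (insert d S)) +
         plucker A (insert a (insert d S)) * plucker A (insert b (insert c S))"
proof -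
  have fin: "finite S" and sub: "insert a (insert b S) \<subseteq> {1..n}"
    and card: "card (insert a (insert b S)) = k"
    using I(1) by (auto simp: nsets_def)
  have k: "k = length (sorted_list_of_set S) + 2" using card fin abcd by simp
  define \<epsilon> where "\<epsilon> = (\<lambda>x. (-1) ^ card {s \<in> S. x < s} :: real)"
  define L where "L = (\<lambda>u v. list_minor A (sorted_list_of_set S @ [u, v]))"
  have pl: "plucker A (insert u (insert v S)) = \<epsilon> u * \<epsilon> v * L u v"
    if "u < v" "u \<in> {a,b,c,d}" "v \<in> {a,b,c,d}" for u v
    unfolding \<epsilon>_def L_def
  proof (rule plucker_insert_two[OF A _ that(1)])
    show "u \<notin> S" "v \<notin> S" using that abcd by auto
    then have "card (insert u (insert v S)) = k" using that fin k by simp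
    then show "insert u (insert v S) \<in> nsets {1..n} k"
      using sub I(2,3) that fin by (auto simp: nsets_def)
  qed
  have "L a b \<noteq> 0" using nz pl[of a b] abcd by auto
  then obtain x y \<delta> where L: "\<And>u v. L u v = \<delta> * (x u * y v - x v * y u)"
    unfolding L_def using list_minor_last_two[OF A[unfolded k]] by metis
  show ?thesis
  proof -
    have eqs: "plucker A (insert a (insert b S)) = \<epsilon> a * \<epsilon> b * L a b"
         "plucker A (insert c (insert d S)) = \<epsilon> c * \<epsilon> d * L c d"
         "plucker A (insert a (insert c S)) = \<epsilon> a * \<epsilon> c * L a c"
         "plucker A (insert b (insert d S)) = \<epsilon> b * \<epsilon> d * L b d"
         "plucker A (insert a (insert d S)) = \<epsilon> a * \<epsilon> d * L a d"
         "plucker A (insert b (insert c S)) = \<epsilon> b * \<epsilon> c * L b c"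
      using abcd by (auto intro!: pl)
    show ?thesis unfolding eqs L by (simp add: algebra_simps)
  qed
qed

section \<open>Scaled Vandermonde matrices\<close>

text \<open>
  Multiplication by the matrix of coefficients of the Newton polynomials \<open>\<Prod>q<r. (X - y q)\<close>, which is
  triangular with ones on the diagonal, turns row \<open>r\<close> into the values of the \<open>r\<close>-th polynomial.
  These vanish at \<open>y c\<close> for \<open>c < r\<close>, so the determinant of the product can be read off.
\<close>
lemma det_scaled_vandermonde:
  fixes s y :: "nat \<Rightarrow> 'a::idom"
  shows "det (mat k k (\<lambda>(r, c). s c * y c ^ r)) = (\<Prod>r<k. s r * (\<Prod>q<r. y r - y q))"
proof -
  define p where "p = (\<lambda>r. \<Prod>q<r. [:- y q, 1:])"
  define T where "T = mat k k (\<lambda>(r, m). coeff (p r) m)"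
  define V where "V = mat k k (\<lambda>(r, c). s c * y c ^ r)"
  have deg: "degree (p r) = r" for r
    unfolding p_def by (simp add: degree_prod_eq_sum_degree)
  have monic: "lead_coeff (p r) = 1" for r
    unfolding p_def lead_coeff_prod by simp
  have poly: "poly (p r) x = (\<Prod>q<r. x - y q)" for r x
    by (simp add: p_def poly_prod)
  have T: "T \<in> carrier_mat k k" and V: "V \<in> carrier_mat k k" by (simp_all add: T_def V_def)
  have "det T = prod_list (diag_mat T)"
    by (rule det_lower_triangular[OF _ T]) (auto simp: T_def deg coeff_eq_0)
  also have "\<dots> = (\<Prod>r = 0..<k. coeff (p r) r)"
    by (simp add: prod_list_diag_prod T_def)
  also have "\<dots> = 1" using monic deg by simp
  finally have "det T = 1" .
  have entry: "(T * V) $$ (r, c) = s c * (\<Prod>q<r. y c - y q)" if "r < k" "c < k" for r c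
  proof -
    have "(T * V) $$ (r, c) = (\<Sum>m = 0..<k. coeff (p r) m * (s c * y c ^ m))"
      using that by (simp add: T_def V_def scalar_prod_def)
    also have "\<dots> = s c * (\<Sum>m<k. coeff (p r) m * y c ^ m)"
      by (simp add: sum_distrib_left mult_ac lessThan_atLeast0)
    also have "(\<Sum>m<k. coeff (p r) m * y c ^ m) = poly (p r) (y c)"
      unfolding poly_altdef
      by (rule sum.mono_neutral_right) (use that deg in \<open>auto simp: coeff_eq_0\<close>)
    finally show ?thesis by (simp add: poly)
  qed
  have "det (T * V) = prod_list (diag_mat (T * V))"
    by (rule det_upper_triangular)
       (use T V in \<open>auto intro!: upper_triangularI simp: entry simp del: index_mult_mat(1)\<close>)
  also have "\<dots> = (\<Prod>r<k. s r * (\<Prod>q<r. y r - y q))"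
    using T by (simp add: prod_list_diag_prod entry lessThan_atLeast0 del: index_mult_mat(1))
  finally show ?thesis
    using det_mult[OF T V] \<open>det T = 1\<close> by (simp add: V_def)
qed

definition scaled_vandermonde :: "nat \<Rightarrow> nat \<Rightarrow> (nat \<Rightarrow> real) \<Rightarrow> real mat" where
  "scaled_vandermonde k n t = mat k n (\<lambda>(r, c). exp (t (c + 1)) * real (c + 1) ^ r)"

lemma plucker_scaled_vandermonde:
  assumes I: "I \<in> nsets {1..n} k"
  shows "plucker (scaled_vandermonde k n t) I =
         exp (\<Sum>i\<in>I. t i) * (\<Prod>j\<in>I. \<Prod>i\<in>{i \<in> I. i < j}. real j - real i)"
proof -
  define xs where "xs = sorted_list_of_set I"
  have fin: "finite I" and card: "card I = k" and sub: "I \<subseteq> {1..n}"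
    using I by (auto simp: nsets_def)
  have len: "length xs = k" and set: "set xs = I" and srt: "sorted_wrt (<) xs"
    using fin card unfolding xs_def by auto
  have range: "1 \<le> xs ! c \<and> xs ! c \<le> n" if "c < k" for c
    using that sub set len nth_mem by fastforce
  have V: "scaled_vandermonde k n t \<in> carrier_mat k n" by (simp add: scaled_vandermonde_def)
  have "plucker (scaled_vandermonde k n t) I = list_minor (scaled_vandermonde k n t) xs"
    unfolding xs_def by (rule plucker_eq_list_minor[OF V I])
  also have "\<dots> = det (mat k k (\<lambda>(r, c). exp (t (xs ! c)) * real (xs ! c) ^ r))"
    unfolding list_minor_def len
  proof (intro arg_cong[of _ _ det] eq_matI, goal_cases)
    case (1 r c)
    then have rc: "r < k" "c < k" by auto
    have "xs ! c - 1 < n" "Suc (xs ! c - 1) = xs ! c" using range[OF rc(2)] by auto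
    then show ?case using rc by (simp add: scaled_vandermonde_def)
  qed auto
  also have "\<dots> = (\<Prod>r<k. exp (t (xs ! r)) * (\<Prod>q<r. real (xs ! r) - real (xs ! q)))"
    by (rule det_scaled_vandermonde)
  also have "\<dots> = (\<Prod>r<k. exp (t (xs ! r)) * (\<Prod>i\<in>{i \<in> I. i < xs ! r}. real (xs ! r) - real i))"
    using prod.reindex_bij_betw[OF bij_betw_nth_less[OF srt], of _ "\<lambda>i. real (xs ! _) - real i"] len set
    by simp
  also have "\<dots> = (\<Prod>j\<in>I. exp (t j) * (\<Prod>i\<in>{i \<in> I. i < j}. real j - real i))"
    by (rule prod.reindex_bij_betw[of "(!) xs" "{..<k}" I])
       (use bij_betw_nth[of xs] srt len set in \<open>auto simp: strict_sorted_iff\<close>)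
  finally show ?thesis by (simp add: prod.distrib exp_sum fin)
qed

lemma rank_le_rows:
  fixes A :: "real mat"
  assumes "A \<in> carrier_mat k n"
  shows "vec_space.rank k A \<le> k"
proof -
  interpret vec_space "TYPE(real)" k .
  have sub: "set (cols A) \<subseteq> carrier_vec k" using assms cols_dim by blast
  have "rank A \<le> dim"
    unfolding rank_def
    by (rule subspace_dim[OF span_is_subspace fin_dim fin_dim_span_cols[OF assms]]) (use sub in simp)
  then show ?thesis by (simp add: dim_is_n)
qed

lemma scaled_vandermonde_full_rank:
  assumes "k \<le> n"
  shows "scaled_vandermonde k n t \<in> full_rank_mats k n"
proof -
  let ?V = "scaled_vandermonde k n t"
  have V: "?V \<in> carrier_mat k n" by (simp add: scaled_vandermonde_def)
  have I: "{1..k} \<in> nsets {1..n} k" using assms by (auto simp: nsets_def)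
  have "plucker ?V {1..k} \<noteq> 0" 
    unfolding plucker_scaled_vandermonde[OF I] by (auto simp: less_imp_neq)
  then have "card {j. j < n \<and> j \<in> (\<lambda>i. i - 1) ` {1..k}} \<le> vec_space.rank k ?V"
    unfolding plucker_def by (rule vec_space.rank_gt_minor[OF V])
  moreover have "{j. j < n \<and> j \<in> (\<lambda>i. i - 1) ` {1..k}} = {..<k}"
    using assms by (auto simp: image_iff intro!: bexI[of _ "Suc _"])
  moreover have "vec_space.rank k ?V \<le> k"
    by (rule rank_le_rows[OF V])
  ultimately show ?thesis using V by (simp add: full_rank_mats_def)
qed

section \<open>Sorted sets and prefix counts\<close>

text \<open>
  The lattice path of a set.  Values are integers so that differences do not truncate.
\<close>
definition prefix_count :: "nat set \<Rightarrow> nat \<Rightarrow> int" where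
  "prefix_count I x = int (card (I \<inter> {1..x}))"

abbreviation prefix_step :: "nat set \<Rightarrow> nat set \<Rightarrow> bool" where
  "prefix_step I J \<equiv> \<forall>x. prefix_count J x \<le> prefix_count I x \<and> prefix_count I x \<le> prefix_count J x + 1"

text \<open>
  An alternating merge of two lists is increasing iff at every threshold the first list is ahead by
  0 or 1.  The lists swap roles in the recursion of \<open>splice\<close>, so lengths differing by 1 must be
  admitted.
\<close>
lemma sorted_wrt_splice_iff:
  fixes xs ys :: "nat list"
  assumes "sorted_wrt (<) xs" "sorted_wrt (<) ys" "set xs \<inter> set ys = {}"
    "length xs = length ys \<or> length xs = length ys + 1"
  shows "sorted_wrt (<) (splice xs ys) \<longleftrightarrow>
         (\<forall>t. length (filter (\<lambda>y. y \<le> t) ys) \<le> length (filter (\<lambda>x. x \<le> t) xs) \<and>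
              length (filter (\<lambda>x. x \<le> t) xs) \<le> length (filter (\<lambda>y. y \<le> t) ys) + 1)"
    (is "_ \<longleftrightarrow> (\<forall>t. ?P xs ys t)")
  using assms
proof (induction xs ys rule: splice.induct)
  case (1 ys)
  then show ?case by simp
next
  case (2 x xs ys)
  have set_splice: "set (splice ys xs) = set ys \<union> set xs"
    using set_shuffles[OF splice_in_shuffles] .
  have less: "x < z" if "z \<in> set xs" for z using 2(2) that by simp
  have IH: "sorted_wrt (<) (splice ys xs) \<longleftrightarrow> (\<forall>t. ?P ys xs t)"
    by (rule 2(1)) (use 2 in auto)
  have none: "filter (\<lambda>z. z \<le> t) zs = []" if "t < x" "\<forall>z\<in>set zs. x < z" for t zs
    using that by (auto simp: filter_empty_conv)
  show ?case
  proof
    assume "sorted_wrt (<) (splice (x # xs) ys)"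
    then have ys: "\<forall>z\<in>set ys. x < z" and P: "\<forall>t. ?P ys xs t"
      using IH by (auto simp: set_splice)
    show "\<forall>t. ?P (x # xs) ys t"
    proof
      fix t
      show "?P (x # xs) ys t"
      proof (cases "x \<le> t")
        case True
        then show ?thesis using P[rule_format, of t] by auto
      next
        case False
        then show ?thesis using none[of t xs] none[of t ys] ys less by auto
      qed
    qed
  next
    assume P: "\<forall>t. ?P (x # xs) ys t"
    have ys: "x < z" if "z \<in> set ys" for z
    proof (rule ccontr)
      assume "\<not> x < z"
      then have "z < x" using 2(4) that by (cases "x = z") auto
      then have "length (filter (\<lambda>y. y \<le> z) ys) = 0"
        using P[rule_format, of z] none[of z xs] less by auto
      then show False using that by (auto simp: filter_empty_conv)
    qed
    have "?P ys xs t" for t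
    proof (cases "x \<le> t")
      case True
      then show ?thesis using P[rule_format, of t] by auto
    next
      case False
      then show ?thesis using none[of t xs] none[of t ys] ys less by auto
    qed
    then show "sorted_wrt (<) (splice (x # xs) ys)" using IH ys less by (auto simp: set_splice)
  qed
qed

lemma interlaced_iff_prefix_step:
  assumes "finite S" "finite T" "S \<inter> T = {}" "0 \<notin> S \<union> T" "card S = card T"
  shows "interlaced S T \<longleftrightarrow> prefix_step S T"
proof -
  have count: "prefix_count U t = int (length (filter (\<lambda>x. x \<le> t) (sorted_list_of_set U)))"
    if "finite U" "0 \<notin> U" for U t
  proof -
    have "U \<inter> {1..t} = set (filter (\<lambda>x. x \<le> t) (sorted_list_of_set U))"
      using that by (auto simp: Suc_le_eq) (metis gr0I)
    then show ?thesis unfolding prefix_count_def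
      by (simp only: distinct_card[OF distinct_filter[OF distinct_sorted_list_of_set]])
  qed
  have 0: "0 \<notin> S" "0 \<notin> T" using assms by auto
  have int_le: "int a \<le> int b + 1 \<longleftrightarrow> a \<le> b + 1" for a b by linarith
  have "interlaced S T \<longleftrightarrow>
      sorted_wrt (<) (splice (sorted_list_of_set S) (sorted_list_of_set T))"
    using assms by (simp add: interlaced_def)
  also have "\<dots> \<longleftrightarrow> prefix_step S T"
    unfolding count[OF assms(1) 0(1)] count[OF assms(2) 0(2)]
    by (subst sorted_wrt_splice_iff) (use assms in \<open>auto simp: int_le\<close>)
  finally show ?thesis .
qed

text \<open>
  Common elements contribute equally to both paths, so the set differences may be replaced by the
  sets.
\<close>
lemma sorted_sets_iff_prefix_step:
  assumes "I \<in> nsets {1..n} k" "J \<in> nsets {1..n} k"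
  shows "sorted_sets I J \<longleftrightarrow> prefix_step I J \<or> prefix_step J I"
proof -
  have fin: "finite I" "finite J" and card: "card I = k" "card J = k" and 0: "0 \<notin> I" "0 \<notin> J"
    using assms by (auto simp: nsets_def)
  have split: "prefix_count U x = prefix_count (U - V) x + prefix_count (U \<inter> V) x"
    if "finite U" for U V x
  proof -
    have "U \<inter> {1..x} = ((U - V) \<inter> {1..x}) \<union> (U \<inter> V \<inter> {1..x})" by auto
    also have "card \<dots> = card ((U - V) \<inter> {1..x}) + card (U \<inter> V \<inter> {1..x})"
      by (rule card_Un_disjoint) auto
    finally show ?thesis by (simp add: prefix_count_def)
  qed
  have diff: "prefix_count I x - prefix_count J x = prefix_count (I - J) x - prefix_count (J - I) x" for x
    using split[OF fin(1), of x J] split[OF fin(2), of x I] by (simp add: Int_commute)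
  have "card (I - J) = card (J - I)"
    using fin card card_Diff_subset_Int[of I J] card_Diff_subset_Int[of J I] by (simp add: Int_commute)
  then have "interlaced (I - J) (J - I) \<longleftrightarrow> prefix_step (I - J) (J - I)"
    "interlaced (J - I) (I - J) \<longleftrightarrow> prefix_step (J - I) (I - J)"
    by (intro interlaced_iff_prefix_step; use fin 0 in auto)+
  moreover have "prefix_step (I - J) (J - I) \<longleftrightarrow> prefix_step I J"
    by (intro iff_allI) (use diff in smt)
  moreover have "prefix_step (J - I) (I - J) \<longleftrightarrow> prefix_step J I"
    by (intro iff_allI) (use diff in smt)
  ultimately show ?thesis by (simp add: sorted_sets_def)
qed

lemma prefix_count_0 [simp]: "prefix_count I 0 = 0"
  by (simp add: prefix_count_def)

lemma prefix_count_full: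
  assumes "I \<in> nsets {1..n} k" "n \<le> x"
  shows "prefix_count I x = int k"
proof -
  have "I \<inter> {1..x} = I" using assms by (auto simp: nsets_def)
  then show ?thesis using assms by (simp add: prefix_count_def nsets_def)
qed

lemma prefix_count_Suc:
  "prefix_count I (Suc x) = prefix_count I x + (if Suc x \<in> I then 1 else 0)"
proof -
  have "I \<inter> {1..Suc x} = (if Suc x \<in> I then insert (Suc x) (I \<inter> {1..x}) else I \<inter> {1..x})"
    by (auto simp: le_Suc_eq)
  then show ?thesis by (simp add: prefix_count_def)
qed

lemma prefix_count_inject:
  assumes "I \<in> nsets {1..n} k" "J \<in> nsets {1..n} k"
    and eq: "\<And>x. x \<le> n \<Longrightarrow> prefix_count I x = prefix_count J x"
  shows "I = J"
proof -
  have "x \<in> I \<longleftrightarrow> x \<in> J" if "x \<in> {1..n}" for x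
    using eq[of x] eq[of "x - 1"] prefix_count_Suc[of I "x - 1"] prefix_count_Suc[of J "x - 1"] that
    by (auto split: if_splits)
  then show ?thesis using assms(1,2) by (auto simp: nsets_def)
qed

text \<open>
  Both paths start at 0.  Hence an oscillation of at most 1 confines their difference to \<open>{0, 1}\<close> or
  to \<open>{-1, 0}\<close>.  Stated through oscillation, sortedness is visibly invariant under vertical
  shifts of the paths, and thereby under cyclic rotation.
\<close>
lemma sorted_sets_iff_oscillation:
  assumes I: "I \<in> nsets {1..n} k" and J: "J \<in> nsets {1..n} k"
  shows "sorted_sets I J \<longleftrightarrow>
    (\<forall>u\<le>n. \<forall>w\<le>n. prefix_count I u - prefix_count J u \<le> prefix_count I w - prefix_count J w + 1)"
    (is "_ \<longleftrightarrow> ?osc")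
proof -
  define D where "D = (\<lambda>x. prefix_count I x - prefix_count J x)"
  have "prefix_step I J \<or> prefix_step J I" if osc: ?osc
  proof -
    have D: "D u \<le> D w + 1" for u w
    proof -
      have clip: "D x = D (min x n)" for x
        using prefix_count_full[OF I] prefix_count_full[OF J] by (cases "x \<le> n") (auto simp: D_def)
      show ?thesis
        using osc[rule_format, of "min u n" "min w n"] clip[of u] clip[of w] by (simp add: D_def)
    qed
    have D0: "D 0 = 0" by (simp add: D_def)
    show ?thesis
    proof (cases "\<exists>u. D u > 0")
      case True
      then obtain u where u: "D u > 0" ..
      have "0 \<le> D x \<and> D x \<le> 1" for x using D[of u x] D[of x 0] D0 u by linarith
      then have "prefix_step I J" by (simp add: D_def diff_le_eq add.commute)
      then show ?thesis ..
    next
      case False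
      have "- 1 \<le> D x \<and> D x \<le> 0" for x using D[of 0 x] D0 False not_less[of 0 "D x"] by auto
      then have "prefix_step J I" by (simp add: D_def algebra_simps)
      then show ?thesis ..
    qed
  qed
  moreover have ?osc if "prefix_step I J \<or> prefix_step J I"
    using that
  proof (elim disjE, goal_cases)
    case 1
    then show ?case by (smt (verit))
  next
    case 2
    then show ?case by (smt (verit))
  qed
  ultimately show ?thesis using sorted_sets_iff_prefix_step[OF I J] by blast
qed

lemma sorted_setsD:
  assumes "sorted_sets I J" "I \<in> nsets {1..n} k" "J \<in> nsets {1..n} k"
  shows "prefix_count I \<le> prefix_count J \<or> prefix_count J \<le> prefix_count I"
    and "prefix_count I x \<le> prefix_count J x + 1"
  using assms(1) unfolding sorted_sets_iff_prefix_step[OF assms(2,3)]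
  by (auto simp: le_fun_def intro: order_trans)

section \<open>Quasi-periodic lattice paths\<close>

text \<open>
  The trivial cases \<open>k = 0\<close> and \<open>k = n\<close> are excluded because a path must have steps of both kinds
  for a point to be raisable.
\<close>
locale height_functions =
  fixes n k :: nat
  assumes k_pos: "0 < k" and k_less: "k < n"
begin

text \<open>
  A lattice path continued to all integers, so that the point \<open>n\<close> is followed by a translated copy
  of the path.  Vertical translates of a path describe the same set, and the pointwise minimum of
  translates is a set operation adapted to a rotated order of \<open>{1..n}\<close>.
\<close>
definition height :: "(int \<Rightarrow> int) \<Rightarrow> bool" where
  "height h \<longleftrightarrow> (\<forall>x. h x \<le> h (x + 1) \<and> h (x + 1) \<le> h x + 1) \<and> (\<forall>x. h (x + int n) = h x + int k)"

definition steps :: "(int \<Rightarrow> int) \<Rightarrow> nat set" where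
  "steps h = {x \<in> {1..n}. h (int x) = h (int x - 1) + 1}"

definition height_of :: "nat set \<Rightarrow> int \<Rightarrow> int" where
  "height_of I x = int k * (x div int n) + prefix_count I (nat (x mod int n))"

text \<open>
  Raising the path at one point modulo \<open>n\<close>; on sets it moves an element one place back, and from 1
  to \<open>n\<close> if the point is \<open>n\<close>.
\<close>
definition bump :: "int \<Rightarrow> (int \<Rightarrow> int) \<Rightarrow> int \<Rightarrow> int" where
  "bump z h = (\<lambda>x. if int n dvd x - z then h x + 1 else h x)"

lemma heightD:
  assumes "height h"
  shows "h x \<le> h (x + 1)" "h (x + 1) \<le> h x + 1" "h (x - 1) \<le> h x" "h x \<le> h (x - 1) + 1"
    "h (x + int n) = h x + int k"
proof -
  have "h y \<le> h (y + 1) \<and> h (y + 1) \<le> h y + 1" for y using assms by (simp add: height_def)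
  from this[of x] this[of "x - 1"]
  show "h x \<le> h (x + 1)" "h (x + 1) \<le> h x + 1" "h (x - 1) \<le> h x" "h x \<le> h (x - 1) + 1"
    by simp_all
  show "h (x + int n) = h x + int k" using assms by (simp add: height_def)
qed

lemma height_shift:
  assumes "height h"
  shows "h (x + int n * m) = h x + int k * m"
proof -
  have nat: "h (y + int n * int j) = h y + int k * int j" for y j
  proof (induction j)
    case (Suc j)
    then show ?case
      using heightD(5)[OF assms, of "y + int n * int j"] by (simp add: algebra_simps)
  qed simp
  show ?thesis
  proof (cases "0 \<le> m")
    case True
    then show ?thesis using nat[of x "nat m"] by simp
  next
    case False
    then show ?thesis using nat[of "x + int n * m" "nat (- m)"] by (simp add: algebra_simps)
  qed
qed

lemma period_representative:
  obtains y m where "y \<in> {1..int n}" "x = y + int n * m"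
proof (rule that)
  show "(x - 1) mod int n + 1 \<in> {1..int n}"
    using k_less pos_mod_bound[of "int n" "x - 1"] pos_mod_sign[of "int n" "x - 1"]
    unfolding atLeastAtMost_iff by linarith
  show "x = (x - 1) mod int n + 1 + int n * ((x - 1) div int n)"
    using mult_div_mod_eq[of "int n" "x - 1"] by linarith
qed

lemma height_le_on_period:
  assumes "height g" "height h" "\<And>x. x \<in> {1..int n} \<Longrightarrow> g x \<le> h x"
  shows "g x \<le> h x"
proof -
  obtain y m where "y \<in> {1..int n}" "x = y + int n * m" by (rule period_representative)
  then show ?thesis using assms(3)[of y] height_shift[OF assms(1)] height_shift[OF assms(2)] by simp
qed

lemma heights_eq_on_period:
  assumes "height g" "height h" "\<And>x. x \<in> {1..int n} \<Longrightarrow> g x = h x"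
  shows "g = h"
  using height_le_on_period[OF assms(1,2)] height_le_on_period[OF assms(2,1)] assms(3)
  by (intro ext antisym) simp_all

lemma height_add_const: "height h \<Longrightarrow> height (\<lambda>x. h x + c)"
  by (simp add: height_def)

lemma height_max:
  assumes "height g" "height h"
  shows "height (\<lambda>x. max (g x) (h x))"
  unfolding height_def
proof (intro conjI allI)
  fix x
  show "max (g x) (h x) \<le> max (g (x + 1)) (h (x + 1))"
    "max (g (x + 1)) (h (x + 1)) \<le> max (g x) (h x) + 1"
    using heightD(1,2)[OF assms(1), of x] heightD(1,2)[OF assms(2), of x] by linarith+
  show "max (g (x + int n)) (h (x + int n)) = max (g x) (h x) + int k"
    using heightD(5)[OF assms(1)] heightD(5)[OF assms(2)] by simp
qed

lemma height_min:
  assumes "height g" "height h"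
  shows "height (\<lambda>x. min (g x) (h x))"
  unfolding height_def
proof (intro conjI allI)
  fix x
  show "min (g x) (h x) \<le> min (g (x + 1)) (h (x + 1))"
    "min (g (x + 1)) (h (x + 1)) \<le> min (g x) (h x) + 1"
    using heightD(1,2)[OF assms(1), of x] heightD(1,2)[OF assms(2), of x] by linarith+
  show "min (g (x + int n)) (h (x + int n)) = min (g x) (h x) + int k"
    using heightD(5)[OF assms(1)] heightD(5)[OF assms(2)] by simp
qed

lemma steps_add_const [simp]: "steps (\<lambda>x. h x + c) = steps h"
  by (simp add: steps_def)

lemma prefix_count_steps:
  assumes "height h" "x \<le> n"
  shows "prefix_count (steps h) x = h (int x) - h 0"
  using assms(2)
proof (induction x)
  case (Suc x)
  have "h (1 + int x) = h (int x) \<or> h (1 + int x) = h (int x) + 1"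
    using heightD(1,2)[OF assms(1), of "int x"] by (auto simp: add.commute)
  then show ?case using Suc by (auto simp: prefix_count_Suc steps_def)
qed simp

lemma steps_in_nsets:
  assumes "height h"
  shows "steps h \<in> nsets {1..n} k"
proof -
  have "prefix_count (steps h) n = int k"
    using prefix_count_steps[OF assms, of n] heightD(5)[OF assms, of 0] by simp
  moreover have "steps h \<inter> {1..n} = steps h" by (auto simp: steps_def)
  ultimately have "card (steps h) = k" by (simp add: prefix_count_def)
  then show ?thesis by (auto simp: nsets_def steps_def)
qed

lemma height_of_eq_prefix_count:
  assumes "I \<in> nsets {1..n} k" "x \<le> n"
  shows "height_of I (int x) = prefix_count I x"
  using assms k_less prefix_count_full[OF assms(1), of n]
  by (cases "x = n") (auto simp: height_of_def)

lemma height_height_of: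
  assumes I: "I \<in> nsets {1..n} k"
  shows "height (height_of I)"
  unfolding height_def
proof (intro conjI allI)
  fix x :: int
  show per: "height_of I (x + int n) = height_of I x + int k" for x
    using k_less by (simp add: height_of_def algebra_simps)
  have step: "height_of I (int y) \<le> height_of I (int y + 1) \<and>
      height_of I (int y + 1) \<le> height_of I (int y) + 1" if "y < n" for y
    using height_of_eq_prefix_count[OF I, of y] height_of_eq_prefix_count[OF I, of "Suc y"]
      prefix_count_Suc[of I y] that by (auto simp: add.commute split: if_splits)
  define y where "y = nat (x mod int n)"
  have y: "y < n" "x = int y + int n * (x div int n)"
    using k_less mult_div_mod_eq[of "int n" x] by (auto simp: y_def nat_less_iff)
  have shift: "height_of I (z + int n * m) = height_of I z + int k * m" for z m
    using k_less by (simp add: height_of_def algebra_simps)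
  have "height_of I x = height_of I (int y) + int k * (x div int n)"
    "height_of I (x + 1) = height_of I (int y + 1) + int k * (x div int n)"
    using shift[of "int y" "x div int n"] shift[of "int y + 1" "x div int n"] y(2)
    by (simp_all add: algebra_simps)
  then show "height_of I x \<le> height_of I (x + 1)" "height_of I (x + 1) \<le> height_of I x + 1"
    using step[OF y(1)] by auto
qed

lemma steps_height_of:
  assumes "I \<in> nsets {1..n} k"
  shows "steps (height_of I) = I"
proof (rule prefix_count_inject[OF steps_in_nsets[OF height_height_of[OF assms]] assms])
  fix x assume "x \<le> n"
  then show "prefix_count (steps (height_of I)) x = prefix_count I x"
    using prefix_count_steps[OF height_height_of[OF assms]] height_of_eq_prefix_count[OF assms]
      height_of_eq_prefix_count[OF assms, of 0] by simp
qed

lemma period_dvd_iff: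
  assumes "x \<in> {1..int n}" "y \<in> {1..int n}"
  shows "int n dvd x - y \<longleftrightarrow> x = y"
  using assms dvd_imp_le_int[of "x - y" "int n"] by (cases "x = y") auto

lemma bump_commute: "bump x (bump y h) = bump y (bump x h)"
  by (auto simp: bump_def)

lemma bump_bump_eq_max:
  assumes "x \<in> {1..int n}" "y \<in> {1..int n}" "x \<noteq> y"
  shows "bump x (bump y h) = (\<lambda>z. max (bump x h z) (bump y h z))"
proof
  fix z
  have "\<not> (int n dvd z - x \<and> int n dvd z - y)"
    using period_dvd_iff[OF assms(1,2)] assms(3) dvd_diff[of "int n" "z - y" "z - x"] by auto
  then show "bump x (bump y h) z = max (bump x h z) (bump y h z)" by (auto simp: bump_def)
qed

lemma height_bumpD:
  assumes h: "height h" and b: "height (bump z h)"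
  shows "h (z - 1) = h z" "h (z + 1) = h z + 1"
proof -
  have "\<not> int n dvd z - 1 - z" "\<not> int n dvd z + 1 - z"
    using k_pos k_less by (auto simp: zdvd_not_zless)
  then show "h (z - 1) = h z" "h (z + 1) = h z + 1"
    using heightD(4)[OF b, of z] heightD(3)[OF h, of z] heightD(1)[OF b, of z] heightD(2)[OF h, of z]
    unfolding bump_def by auto
qed

text \<open>
  The step into \<open>z\<close> becomes upward and the step out of \<open>z\<close> becomes level.  As a period has length at
  least 2, no step changes at both of its ends.
\<close>
lemma height_bumpI:
  assumes h: "height h" and z: "h (z - 1) = h z" "h (z + 1) = h z + 1"
  shows "height (bump z h)"
  unfolding height_def
proof (intro conjI allI)
  fix x
  have n2: "\<not> int n dvd 1" using k_pos k_less by auto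
  have shift: "h (y + (x - z)) = h y + int k * ((x - z) div int n)" if "int n dvd x - z" for x y
    using height_shift[OF h, of y "(x - z) div int n"] that by simp
  have 1: "h (x + 1) = h x + 1" "\<not> int n dvd x + 1 - z" if "int n dvd x - z"
    using shift[OF that, of z] shift[OF that, of "z + 1"] z n2 that
      dvd_diff[of "int n" "x + 1 - z" "x - z"] by (auto simp: algebra_simps)
  have 2: "h (x + 1) = h x" "\<not> int n dvd x - z" if "int n dvd x + 1 - z"
    using shift[OF that, of "z - 1"] shift[OF that, of z] z n2 that
      dvd_diff[of "int n" "x + 1 - z" "x - z"] by (auto simp: algebra_simps)
  show "bump z h x \<le> bump z h (x + 1)" "bump z h (x + 1) \<le> bump z h x + 1"
    using 1 2 heightD(1,2)[OF h, of x] by (auto simp: bump_def)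
  have "int n dvd x + int n - z \<longleftrightarrow> int n dvd x - z"
    using dvd_add_left_iff[of "int n" "int n" "x - z"] by (simp add: algebra_simps)
  then show "bump z h (x + int n) = bump z h x + int k"
    using heightD(5)[OF h] by (simp add: bump_def)
qed

text \<open>
  Interpolation between two comparable paths.  A point where \<open>g\<close> can be raised without exceeding \<open>h\<close>
  is found where \<open>g\<close> is lowest relative to the line of slope \<open>k / n\<close>, among the points where
  \<open>g < h\<close>: there the neighbouring steps of \<open>g\<close> are forced, either by the minimality or by the steps
  of \<open>h\<close>.
\<close>
lemma bump_between:
  assumes "height g" "height h" "\<And>x. g x \<le> h x" "g \<noteq> h"
  obtains z where "z \<in> {1..int n}" "g z < h z" "height (bump z g)" "\<And>x. bump z g x \<le> h x"
proof -
  define A where "A = {x \<in> {1..int n}. g x < h x}"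
  \<comment> \<open>The height above the line of slope \<open>k / n\<close>, scaled by \<open>n\<close>; it is
    periodic.\<close>
  define \<phi> where "\<phi> = (\<lambda>x. int n * g x - int k * x)"
  have "A \<noteq> {}"
  proof
    assume "A = {}"
    then have "g = h"
      using assms(3) by (intro heights_eq_on_period[OF assms(1,2)] antisym) (auto simp: A_def not_less)
    then show False using assms(4) by simp
  qed
  moreover have "finite A" unfolding A_def by (rule finite_subset[of _ "{1..int n}"]) auto
  ultimately obtain z where z: "z \<in> A" and min_A: "\<And>y. y \<in> A \<Longrightarrow> \<phi> z \<le> \<phi> y"
    using arg_min_if_finite[of A \<phi>] by (meson not_less)
  have min: "\<phi> z \<le> \<phi> x" if "g x < h x" for x
  proof -
    obtain y m where y: "y \<in> {1..int n}" and x: "x = y + int n * m" by (rule period_representative)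
    have "g y < h y" using that x height_shift[OF assms(1)] height_shift[OF assms(2)] by simp
    moreover have "\<phi> y = \<phi> x"
      unfolding \<phi>_def x height_shift[OF assms(1)] by (simp add: algebra_simps)
    ultimately show ?thesis using min_A[of y] y by (simp add: A_def)
  qed
  have gz: "g z < h z" using z by (simp add: A_def)
  \<comment> \<open>An upward step into \<open>z\<close> would raise \<open>\<phi>\<close> by \<open>n - k >
    0\<close>, so \<open>z - 1\<close> would be a better choice.\<close>
  have "g z \<le> g (z - 1)"
  proof (cases "g (z - 1) < h (z - 1)")
    case True
    have "int n * (g z - g (z - 1)) \<le> int k" using min[OF True] by (simp add: \<phi>_def algebra_simps)
    then have "int n * (g z - g (z - 1)) < int n * 1" using k_less by linarith
    then show ?thesis using k_less by (simp add: mult_less_cancel_left)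
  next
    case False
    then show ?thesis using gz heightD(4)[OF assms(2), of z] assms(3)[of "z - 1"] by linarith
  qed
  \<comment> \<open>A level step out of \<open>z\<close> would lower \<open>\<phi>\<close> by \<open>k > 0\<close>.\<close>
  moreover have "g z + 1 \<le> g (z + 1)"
  proof (cases "g (z + 1) < h (z + 1)")
    case True
    have "int k \<le> int n * (g (z + 1) - g z)" using min[OF True] by (simp add: \<phi>_def algebra_simps)
    then have "int n * 0 < int n * (g (z + 1) - g z)" using k_pos by linarith
    then have "0 < g (z + 1) - g z" using k_less by (simp only: mult_less_cancel_left)
    then show ?thesis by simp
  next
    case False
    then show ?thesis using gz heightD(1)[OF assms(2), of z] by linarith
  qed
  ultimately have b: "height (bump z g)"
    using heightD[OF assms(1), of z] by (intro height_bumpI[OF assms(1)]) auto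
  have "bump z g x \<le> h x" for x
  proof (cases "int n dvd x - z")
    case True
    then obtain m where "x - z = int n * m" by (rule dvdE)
    then have "x = z + int n * m" by simp
    then show ?thesis using gz height_shift[OF assms(1), of z m] height_shift[OF assms(2), of z m]
      by (simp add: bump_def)
  qed (use assms(3) in \<open>simp add: bump_def\<close>)
  then show thesis using that b gz z by (simp add: A_def)
qed

end

section \<open>Supermodularity and the sortedness of maximisers\<close>

text \<open>
  What positivity extracts from the three-term relation: of the three ways to split
  \<open>{a, b, c, d}\<close> into two pairs, the crossing one strictly wins.
\<close>
definition crossing_supermodular :: "nat \<Rightarrow> nat \<Rightarrow> (nat set \<Rightarrow> real) \<Rightarrow> bool" where
  "crossing_supermodular n k f \<longleftrightarrow>
     (\<forall>S a b c d. a < b \<and> b < c \<and> c < d \<and> {a, b, c, d} \<inter> S = {} \<and>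
        insert a (insert b S) \<in> nsets {1..n} k \<and> c \<in> {1..n} \<and> d \<in> {1..n} \<longrightarrow>
        f (insert a (insert b S)) + f (insert c (insert d S)) < f (insert a (insert c S)) + f (insert b (insert d S)) \<and>
        f (insert a (insert d S)) + f (insert b (insert c S)) < f (insert a (insert c S)) + f (insert b (insert d S)))"

lemma crossing_supermodular_ln_plucker:
  assumes A: "A \<in> carrier_mat k n" and pos: "\<And>I. I \<in> nsets {1..n} k \<Longrightarrow> 0 < plucker A I"
  shows "crossing_supermodular n k (\<lambda>I. ln (plucker A I))"
  unfolding crossing_supermodular_def
proof (intro allI impI, elim conjE)
  fix S a b c d
  assume abcd: "a < b" "b < c" "c < d" "{a, b, c, d} \<inter> S = {}"
    and I: "insert a (insert b S) \<in> nsets {1..n} k" "c \<in> {1..n}" "d \<in> {1..n}"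
  have mem: "insert u (insert v S) \<in> nsets {1..n} k"
    if "u \<noteq> v" "u \<in> {a, b, c, d}" "v \<in> {a, b, c, d}" for u v
  proof -
    have fin: "finite S" using I(1) by (simp add: nsets_def)
    have "u \<notin> S" "v \<notin> S" using that abcd(4) by auto
    then have "card (insert u (insert v S)) = card (insert a (insert b S))"
      using fin abcd that(1) by simp
    then show ?thesis using I that fin by (auto simp: nsets_def)
  qed
  let ?p = "\<lambda>u v. plucker A (insert u (insert v S))"
  have p: "0 < ?p a b" "0 < ?p c d" "0 < ?p a c" "0 < ?p b d" "0 < ?p a d" "0 < ?p b c"
    using abcd by (auto intro!: pos mem)
  have "?p a c * ?p b d = ?p a b * ?p c d + ?p a d * ?p b c"
    using three_term_plucker_relation[OF A abcd I] p(1) by simp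
  then have "?p a b * ?p c d < ?p a c * ?p b d" "?p a d * ?p b c < ?p a c * ?p b d"
    using p by simp_all
  then have "ln (?p a b * ?p c d) < ln (?p a c * ?p b d)" "ln (?p a d * ?p b c) < ln (?p a c * ?p b d)"
    using p by simp_all
  then show "ln (?p a b) + ln (?p c d) < ln (?p a c) + ln (?p b d) \<and>
      ln (?p a d) + ln (?p b c) < ln (?p a c) + ln (?p b d)"
    using p by (simp add: ln_mult)
qed

context height_functions
begin

definition next_mod :: "nat \<Rightarrow> nat" where
  "next_mod x = (if x = n then 1 else x + 1)"

text \<open>
  A point that can be raised has a level step into it and an upward step out of it; raising it
  interchanges the two.
\<close>
lemma steps_bump:
  assumes h: "height h" and b: "height (bump (int x) h)" and x: "x \<in> {1..n}"
  shows "x \<notin> steps h" "next_mod x \<in> steps h" "steps (bump (int x) h) = insert x (steps h - {next_mod x})"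
proof -
  have hx: "h (int x - 1) = h (int x)" "h (int x + 1) = h (int x) + 1"
    using height_bumpD[OF h b] by auto
  then show "x \<notin> steps h" by (simp add: steps_def)
  have n: "int n dvd int y - int x \<longleftrightarrow> y = x" "int n dvd int y - 1 - int x \<longleftrightarrow> y = next_mod x"
    if y: "y \<in> {1..n}" for y
  proof -
    show "int n dvd int y - int x \<longleftrightarrow> y = x" using period_dvd_iff[of "int y" "int x"] x y by auto
    show "int n dvd int y - 1 - int x \<longleftrightarrow> y = next_mod x"
    proof (cases "x = n")
      case True
      then have "int n dvd int y - 1 - int x \<longleftrightarrow> int n dvd int y - 1"
        using dvd_add_left_iff[of "int n" "- int n" "int y - 1"] by simp
      also have "\<dots> \<longleftrightarrow> y = 1"
        using period_dvd_iff[of "int y" 1] y by auto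
      finally show ?thesis using True by (simp add: next_mod_def)
    next
      case False
      then have "int n dvd int y - (int x + 1) \<longleftrightarrow> int y = int x + 1"
        using period_dvd_iff[of "int y" "int x + 1"] x y by auto
      then show ?thesis using False by (auto simp: next_mod_def algebra_simps)
    qed
  qed
  show "next_mod x \<in> steps h"
    using hx x heightD(5)[OF h, of 0] heightD(5)[OF h, of 1] k_less
    by (cases "x = n") (auto simp: next_mod_def steps_def add.commute)
  then show "steps (bump (int x) h) = insert x (steps h - {next_mod x})"
    using n x hx k_pos k_less by (auto simp: steps_def bump_def)
qed

context
  fixes f :: "nat set \<Rightarrow> real"
  assumes crossing: "crossing_supermodular n k f"
begin

text \<open>
  The two exchanged pairs \<open>{x, x + 1}\<close> and \<open>{y, y + 1}\<close> are disjoint arcs of the cycle.  Leaving both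
  or moving both gives the two crossing pairs, moving just one gives a noncrossing splitting.
\<close>
lemma square_inequality:
  assumes h: "height h" and bx: "height (bump (int x) h)" and b_y: "height (bump (int y) h)"
    and x: "x \<in> {1..n}" and y: "y \<in> {1..n}" and xy: "x < y"
  shows "f (steps (bump (int x) h)) + f (steps (bump (int y) h)) <
         f (steps h) + f (steps (bump (int x) (bump (int y) h)))"
proof -
  have bxy: "height (bump (int x) (bump (int y) h))"
    using height_max[OF bx b_y] bump_bump_eq_max[of "int x" "int y"] x y xy by simp
  note sx = steps_bump[OF h bx x] and sy = steps_bump[OF h b_y y] and sxy = steps_bump[OF b_y bxy x]
  define S where "S = steps h - {next_mod x, next_mod y}"
  have ne: "next_mod x \<noteq> next_mod y" "x \<noteq> next_mod x" "y \<noteq> next_mod y" "x \<noteq> next_mod y" "y \<noteq> next_mod x"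
    using xy x y sx sy k_pos k_less by (auto simp: next_mod_def split: if_splits)
  have eqs: "steps h = insert (next_mod x) (insert (next_mod y) S)"
    "steps (bump (int x) h) = insert x (insert (next_mod y) S)"
    "steps (bump (int y) h) = insert y (insert (next_mod x) S)"
    "steps (bump (int x) (bump (int y) h)) = insert x (insert y S)"
    using sx sy sxy ne by (auto simp: S_def)
  have S: "x \<notin> S" "y \<notin> S" "next_mod x \<notin> S" "next_mod y \<notin> S"
    using sx sy by (auto simp: S_def)
  have mem: "steps (bump (int x) h) \<in> nsets {1..n} k" "steps h \<in> nsets {1..n} k"
    "steps (bump (int x) (bump (int y) h)) \<in> nsets {1..n} k"
    using steps_in_nsets bx h bxy by auto
  have sx_eq: "next_mod x = x + 1" "next_mod x \<in> {1..n}" using xy y by (auto simp: next_mod_def)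
  have less: "x + 1 < y" using xy ne(5) sx_eq by auto
  show ?thesis
  proof (cases "y = n")
    case False
    then have ny: "next_mod y = y + 1" "y + 1 \<in> {1..n}" using y by (auto simp: next_mod_def)
    have "insert x (insert (x + 1) S) \<in> nsets {1..n} k"
      using mem(1) S sx_eq ny ne x by (auto simp: eqs nsets_def)
    then show ?thesis
      using crossing[unfolded crossing_supermodular_def, rule_format, of x "x + 1" y "y + 1" S]
        less S sx_eq ny y unfolding eqs by (simp add: insert_commute add.commute)
  next
    case True
    \<comment> \<open>In this case the second arc is \<open>{n, 1}\<close>, and 1 becomes the smallest of the four
      elements.\<close>
    then have ny: "next_mod y = 1" by (simp add: next_mod_def)
    have "1 < x" using x ne ny by auto
    moreover have "insert 1 (insert x S) \<in> nsets {1..n} k"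
      using mem(1) by (simp add: eqs ny insert_commute)
    ultimately show ?thesis
      using crossing[unfolded crossing_supermodular_def, rule_format, of 1 x "x + 1" y S]
        less S sx_eq ny y unfolding eqs by (simp add: insert_commute add.commute)
  qed
qed

text \<open>
  A strip of squares: \<open>m\<close> is raised to \<open>q\<close> point by point, and the gain caused by a bump at \<open>x\<close>
  strictly increases with every such step.
\<close>
lemma bump_supermodular:
  assumes "height m" "height q" "\<And>z. m z \<le> q z"
    and "height (bump x m)" "x \<in> {1..int n}" "q x = m x"
  shows "height (bump x q) \<and> bump x q = (\<lambda>z. max (q z) (bump x m z)) \<and>
    (m \<noteq> q \<longrightarrow> f (steps (bump x m)) + f (steps q) < f (steps m) + f (steps (bump x q)))"
  using assms
proof (induction "nat (\<Sum>z\<in>{1..int n}. q z - m z)" arbitrary: m rule: less_induct)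
  case (less m)
  have max: "bump x q = (\<lambda>z. max (q z) (bump x m z))"
  proof
    fix z
    show "bump x q z = max (q z) (bump x m z)"
    proof (cases "int n dvd z - x")
      case True
      then obtain j where "z - x = int n * j" by (rule dvdE)
      then have "z = x + int n * j" by simp
      then have "q z = m z"
        using less.prems(6) height_shift[OF less.prems(1)] height_shift[OF less.prems(2)] by simp
      then show ?thesis using True by (simp add: bump_def)
    qed (use less.prems(3) in \<open>simp add: bump_def\<close>)
  qed
  have bxq: "height (bump x q)" unfolding max by (rule height_max[OF less.prems(2,4)])
  show ?case
  proof (cases "m = q")
    case False
    then obtain y where y: "y \<in> {1..int n}" "m y < q y" "height (bump y m)" "\<And>z. bump y m z \<le> q z"
      using bump_between[OF less.prems(1-3)] by blast
    have xy: "x \<noteq> y" using y(2) less.prems(6) by auto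
    have bxy: "height (bump x (bump y m))"
      using height_max[OF less.prems(4) y(3)] bump_bump_eq_max[OF less.prems(5) y(1) xy] by simp
    define a b where "a = nat x" and "b = nat y"
    have ab: "x = int a" "a \<in> {1..n}" "y = int b" "b \<in> {1..n}"
      using less.prems(5) y(1) by (auto simp: a_def b_def)
    have "f (steps (bump x m)) + f (steps (bump y m)) < f (steps m) + f (steps (bump x (bump y m)))"
    proof (cases "x < y")
      case True
      then show ?thesis
        using square_inequality[OF less.prems(1), of a b] y(3) less.prems(4) ab by auto
    next
      case False
      then show ?thesis
        using square_inequality[OF less.prems(1), of b a] y(3) xy less.prems(4) ab
        unfolding ab(1,3) bump_commute[of "int a" "int b"] by auto
    qed
    moreover have "f (steps (bump x (bump y m))) + f (steps q) \<le> f (steps (bump y m)) + f (steps (bump x q))"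
    proof (cases "bump y m = q")
      case False
      have "nat (\<Sum>z\<in>{1..int n}. q z - bump y m z) < nat (\<Sum>z\<in>{1..int n}. q z - m z)"
      proof -
        have "(\<Sum>z\<in>{1..int n}. q z - bump y m z) < (\<Sum>z\<in>{1..int n}. q z - m z)"
          by (rule sum_strict_mono_ex1) (use y(1) in \<open>auto simp: bump_def intro!: bexI[of _ y]\<close>)
        moreover have "0 \<le> (\<Sum>z\<in>{1..int n}. q z - bump y m z)"
          by (rule sum_nonneg) (use y(4) in auto)
        ultimately show ?thesis by linarith
      qed
      moreover have "q x = bump y m x"
        using less.prems(5,6) period_dvd_iff[OF less.prems(5) y(1)] xy by (simp add: bump_def)
      ultimately show ?thesis
        using less.hyps[of "bump y m"] y(3,4) less.prems(2,5) bxy False by fastforce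
    qed simp
    ultimately show ?thesis using max bxq by linarith
  qed (use max bxq in simp)
qed

text \<open>
  The rectangle spanned by \<open>min p q\<close> and \<open>max p q\<close> is cut into strips by raising the minimum to \<open>p\<close>
  point by point.
\<close>
lemma incomparable_supermodular:
  assumes "height p" "height q" "\<exists>u. p u < q u" "\<exists>w. q w < p w"
  shows "f (steps p) + f (steps q) <
         f (steps (\<lambda>z. min (p z) (q z))) + f (steps (\<lambda>z. max (p z) (q z)))"
  using assms
proof (induction "nat (\<Sum>z\<in>{1..int n}. p z - min (p z) (q z))" arbitrary: q rule: less_induct)
  case (less q)
  define m where "m = (\<lambda>z. min (p z) (q z))"
  have m: "height m" unfolding m_def by (rule height_min[OF less.prems(1,2)])
  have le: "m z \<le> p z" "m z \<le> q z" for z by (simp_all add: m_def)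
  obtain u w where "p u < q u" "q w < p w" using less.prems(3,4) by blast
  then have "m u \<noteq> q u" "m w \<noteq> p w" by (simp_all add: m_def)
  then have ne: "m \<noteq> p" "m \<noteq> q" by auto
  \<comment> \<open>A bump of the minimum below \<open>p\<close> happens where \<open>q\<close> is the smaller path,
    so it bumps \<open>q\<close> as well.\<close>
  obtain x where x: "x \<in> {1..int n}" "m x < p x" "height (bump x m)" "\<And>z. bump x m z \<le> p z"
    using bump_between[OF m less.prems(1) le(1) ne(1)] by blast
  have qx: "q x = m x" using x(2) by (auto simp: m_def min_def split: if_splits)
  define q' where "q' = bump x q"
  have q': "height q'" "q' = (\<lambda>z. max (q z) (bump x m z))"
    and lower: "f (steps (bump x m)) + f (steps q) < f (steps m) + f (steps q')"
    using bump_supermodular[OF m less.prems(2) le(2) x(3,1) qx] ne(2) by (auto simp: q'_def)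
  have max_eq: "(\<lambda>z. max (p z) (q' z)) = (\<lambda>z. max (p z) (q z))"
    using x(4) by (auto simp: q'(2) fun_eq_iff max_def intro: antisym order_trans)
  have min_eq: "(\<lambda>z. min (p z) (q' z)) = bump x m"
  proof
    fix z
    show "min (p z) (q' z) = bump x m z"
      using x(4)[of z] le[of z] by (auto simp: q'(2) bump_def m_def)
  qed
  show ?case
  proof (cases "bump x m = p")
    case True
    then have "(\<lambda>z. max (p z) (q z)) = q'" using q'(2) by (simp add: max.commute)
    then show ?thesis using lower True by (simp add: m_def)
  next
    case False
    have "\<exists>u. p u < q' u" using less.prems(3) q'(2) by (auto simp: less_max_iff_disj)
    moreover have "\<exists>w. q' w < p w"
    proof (rule ccontr)
      assume "\<not> (\<exists>w. q' w < p w)"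
      then have "bump x m = p" unfolding min_eq[symmetric] by (auto simp: fun_eq_iff not_less)
      then show False using False by simp
    qed
    moreover have "nat (\<Sum>z\<in>{1..int n}. p z - min (p z) (q' z)) < nat (\<Sum>z\<in>{1..int n}. p z - min (p z) (q z))"
    proof -
      have "(\<Sum>z\<in>{1..int n}. p z - bump x m z) < (\<Sum>z\<in>{1..int n}. p z - m z)"
        by (rule sum_strict_mono_ex1) (use x(1) in \<open>auto simp: bump_def intro!: bexI[of _ x]\<close>)
      moreover have "0 \<le> (\<Sum>z\<in>{1..int n}. p z - bump x m z)"
        by (rule sum_nonneg) (use x(4) in auto)
      ultimately show ?thesis using fun_cong[OF min_eq] by (simp add: m_def)
    qed
    ultimately have "f (steps p) + f (steps q') < f (steps (bump x m)) + f (steps (\<lambda>z. max (p z) (q z)))"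
      using less.hyps[OF _ less.prems(1) q'(1)] min_eq max_eq by simp
    then show ?thesis using lower by (simp add: m_def)
  qed
qed

text \<open>
  If the difference \<open>D\<close> of the two paths exceeds \<open>D w\<close> by 2 or more somewhere, shifting the path of
  \<open>J\<close> by \<open>D w + 1\<close> makes the paths incomparable without changing the sets.  Strict supermodularity then
  produces a larger value.
\<close>
lemma maximizers_sorted:
  assumes I: "I \<in> nsets {1..n} k" and J: "J \<in> nsets {1..n} k"
    and max: "\<And>K. K \<in> nsets {1..n} k \<Longrightarrow> f K \<le> f I" "f J = f I"
  shows "sorted_sets I J"
proof -
  define D where "D = (\<lambda>x. height_of I x - height_of J x)"
  note hI = height_height_of[OF I] and hJ = height_height_of[OF J]
  have D: "D u \<le> D w + 1" for u w
  proof (rule ccontr)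
    assume "\<not> D u \<le> D w + 1"
    define q where "q = (\<lambda>x. height_of J x + (D w + 1))"
    have "q u < height_of I u" "height_of I w < q w"
      using \<open>\<not> D u \<le> D w + 1\<close> by (simp_all add: q_def D_def)
    moreover have q: "height q" unfolding q_def by (rule height_add_const[OF hJ])
    ultimately have "f (steps (height_of I)) + f (steps q) <
        f (steps (\<lambda>z. min (height_of I z) (q z))) + f (steps (\<lambda>z. max (height_of I z) (q z)))"
      by (intro incomparable_supermodular[OF hI]) auto
    moreover have "steps q = J" unfolding q_def steps_add_const by (rule steps_height_of[OF J])
    ultimately show False
      using max(1)[OF steps_in_nsets[OF height_min[OF hI q]]]
        max(1)[OF steps_in_nsets[OF height_max[OF hI q]]] max(2) steps_height_of[OF I] by simp
  qed
  show ?thesis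
    unfolding sorted_sets_iff_oscillation[OF I J]
    using D height_of_eq_prefix_count[OF I] height_of_eq_prefix_count[OF J]
    unfolding D_def by metis
qed

end
end

section \<open>Sorted families are sets of largest minors\<close>

text \<open>
  A set \<open>K\<close> that looks like some member on each interval is comparable with all members, and its
  path splits the chain \<open>\<J>\<close> into an upper part \<open>A\<close> and a lower part \<open>B\<close>.  If \<open>K\<close> were not a
  member, it would differ from the least path of \<open>A\<close> at some \<open>u\<close> and from the greatest path of \<open>B\<close>
  at some \<open>w\<close>, and between \<open>u\<close> and \<open>w\<close> the count of \<open>K\<close> would differ from that of every member.
  If one of the parts is empty, the point 0 replaces \<open>u\<close> or \<open>w\<close>.
\<close>
lemma sorted_family_interval_closed:
  assumes \<J>: "\<J> \<subseteq> nsets {1..n} k" "\<J> \<noteq> {}" "sorted_family \<J>"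
    and K: "K \<in> nsets {1..n} k"
    and agree: "\<And>a b. a < b \<Longrightarrow> b \<le> n \<Longrightarrow> \<exists>I\<in>\<J>. prefix_count K b - prefix_count K a = prefix_count I b - prefix_count I a"
  shows "K \<in> \<J>"
proof (rule ccontr)
  assume notin: "K \<notin> \<J>"
  have sub: "I \<in> nsets {1..n} k" if "I \<in> \<J>" for I using that \<J>(1) by blast
  have fin: "finite \<J>"
    using \<J>(1) finite_imp_finite_nsets[of "{1..n}" k] by (auto intro: finite_subset)
  have sorted: "sorted_sets I J" if "I \<in> \<J>" "J \<in> \<J>" for I J
    using \<J>(3) that by (simp add: sorted_family_def)
  have up: "prefix_count I x \<le> prefix_count J x + 1" if "I \<in> \<J>" "J \<in> \<J>" for I J x
    using sorted_setsD(2)[OF sorted[OF that] sub[OF that(1)] sub[OF that(2)]] .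
  have comp: "prefix_count I \<le> prefix_count J \<or> prefix_count J \<le> prefix_count I"
    if "I \<in> \<J>" "J \<in> \<J>" for I J
    using sorted_setsD(1)[OF sorted[OF that] sub[OF that(1)] sub[OF that(2)]] .
  have agree': "\<exists>I\<in>\<J>. prefix_count K u - prefix_count K w = prefix_count I u - prefix_count I w"
    if "u \<le> n" "w \<le> n" for u w
  proof (cases u w rule: linorder_cases)
    case less
    then obtain I where "I \<in> \<J>"
      "prefix_count K w - prefix_count K u = prefix_count I w - prefix_count I u"
      using agree[of u w] \<open>w \<le> n\<close> by blast
    then show ?thesis by (intro bexI[of _ I]) linarith+
  next
    case equal
    then show ?thesis using \<J>(2) by auto
  next
    case greater
    then show ?thesis using agree[of w u] that by fastforce
  qed
  have K_comp: "prefix_count K \<le> prefix_count I \<or> prefix_count I \<le> prefix_count K" if I: "I \<in> \<J>" for I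
  proof -
    have "prefix_count K u - prefix_count I u \<le> prefix_count K w - prefix_count I w + 1"
      if "u \<le> n" "w \<le> n" for u w
    proof -
      obtain J where J: "J \<in> \<J>" "prefix_count K u - prefix_count K w = prefix_count J u - prefix_count J w"
        using agree'[of u w] \<open>u \<le> n\<close> \<open>w \<le> n\<close> by blast
      have "prefix_count J u - prefix_count I u \<le> prefix_count J w - prefix_count I w + 1"
        using sorted[OF J(1) I] sorted_sets_iff_oscillation[OF sub[OF J(1)] sub[OF I]] that by blast
      then show ?thesis using J(2) by linarith
    qed
    then have "sorted_sets K I" by (simp add: sorted_sets_iff_oscillation[OF K sub[OF I]])
    then show ?thesis using sorted_setsD(1)[OF _ K sub[OF I]] by blast
  qed
  have differ: "\<exists>x\<le>n. prefix_count I x \<noteq> prefix_count K x" if "I \<in> \<J>" for I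
    using prefix_count_inject[OF sub[OF that] K] that notin by blast
  define A where "A = {I \<in> \<J>. prefix_count K \<le> prefix_count I}"
  define B where "B = {I \<in> \<J>. prefix_count I \<le> prefix_count K}"
  have AB: "I \<in> A \<or> I \<in> B" if "I \<in> \<J>" for I using K_comp[OF that] that by (auto simp: A_def B_def)
  have A: "\<exists>u\<le>n. \<forall>I\<in>A. prefix_count K u + 1 \<le> prefix_count I u" if "A \<noteq> {}"
  proof -
    have "finite (prefix_count ` A)" "prefix_count ` A \<noteq> {}" using fin that by (auto simp: A_def)
    then obtain P where P: "P \<in> A" "\<And>I. I \<in> A \<Longrightarrow> prefix_count I \<le> prefix_count P \<Longrightarrow> prefix_count P = prefix_count I"
      using finite_has_minimal[of "prefix_count ` A"] by (metis (no_types, lifting) imageE imageI)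
    have least: "prefix_count P \<le> prefix_count I" if "I \<in> A" for I
      using comp[of P I] P(1) P(2)[OF that] that by (auto simp: A_def)
    obtain u where u: "u \<le> n" "prefix_count P u \<noteq> prefix_count K u"
      using differ[of P] P(1) by (auto simp: A_def)
    moreover have "prefix_count K u \<le> prefix_count P u" using P(1) by (simp add: A_def le_fun_def)
    ultimately have "prefix_count K u + 1 \<le> prefix_count P u" by linarith
    then show ?thesis using u(1) least by (meson le_funD order_trans)
  qed
  have B: "\<exists>w\<le>n. \<forall>I\<in>B. prefix_count I w + 1 \<le> prefix_count K w" if "B \<noteq> {}"
  proof -
    have "finite (prefix_count ` B)" "prefix_count ` B \<noteq> {}" using fin that by (auto simp: B_def)
    then obtain P where P: "P \<in> B" "\<And>I. I \<in> B \<Longrightarrow> prefix_count P \<le> prefix_count I \<Longrightarrow> prefix_count P = prefix_count I"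
      using finite_has_maximal[of "prefix_count ` B"] by (metis (no_types, lifting) imageE imageI)
    have greatest: "prefix_count I \<le> prefix_count P" if "I \<in> B" for I
      using comp[of P I] P(1) P(2)[OF that] that by (auto simp: B_def)
    obtain w where w: "w \<le> n" "prefix_count P w \<noteq> prefix_count K w"
      using differ[of P] P(1) by (auto simp: B_def)
    moreover have "prefix_count P w \<le> prefix_count K w" using P(1) by (simp add: B_def le_fun_def)
    ultimately have "prefix_count P w + 1 \<le> prefix_count K w" by linarith
    then show ?thesis using w(1) greatest by (meson add_right_mono le_funD order_trans)
  qed
  have "\<exists>u\<le>n. \<exists>w\<le>n. \<forall>I\<in>\<J>. prefix_count I u - prefix_count I w \<noteq> prefix_count K u - prefix_count K w"
  proof (cases "A = {} \<or> B = {}")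
    case True
    then show ?thesis
    proof
      assume "A = {}"
      then have "B \<noteq> {}" "\<J> = B" using AB \<J>(2) by (auto simp: B_def)
      then show ?thesis using B by (intro exI[of _ 0]) fastforce
    next
      assume "B = {}"
      then have "A \<noteq> {}" "\<J> = A" using AB \<J>(2) by (auto simp: A_def)
      then show ?thesis using A by fastforce
    qed
  next
    case False
    then obtain u w where u: "u \<le> n" "\<And>I. I \<in> A \<Longrightarrow> prefix_count K u + 1 \<le> prefix_count I u"
      and w: "w \<le> n" "\<And>I. I \<in> B \<Longrightarrow> prefix_count I w + 1 \<le> prefix_count K w"
      using A B by blast
    obtain P Q where P: "P \<in> A" and Q: "Q \<in> B" using False by blast
    have "prefix_count I u - prefix_count I w = prefix_count K u - prefix_count K w + 1" if I: "I \<in> \<J>" for I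
    proof -
      have in\<J>: "P \<in> \<J>" "Q \<in> \<J>" using P Q by (auto simp: A_def B_def)
      have le: "prefix_count K w \<le> prefix_count I w" if "I \<in> A"
        using that by (simp add: A_def le_fun_def)
      have ge: "prefix_count I u \<le> prefix_count K u" if "I \<in> B"
        using that by (simp add: B_def le_fun_def)
      have "prefix_count Q u \<le> prefix_count K u" "prefix_count K w \<le> prefix_count P w"
        using P Q by (simp_all add: A_def B_def le_fun_def)
      then show ?thesis
        using AB[OF I] u(2)[OF P] w(2)[OF Q] u(2)[of I] w(2)[of I] le ge
          up[OF I in\<J>(1), of u] up[OF I in\<J>(2), of u] up[OF I in\<J>(1), of w] up[OF I in\<J>(2), of w]
          up[OF in\<J>(1) I, of u] up[OF in\<J>(2) I, of u] up[OF in\<J>(1) I, of w] up[OF in\<J>(2) I, of w]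
        by linarith
    qed
    then show ?thesis using u(1) w(1) by (intro exI[of _ u] conjI exI[of _ w]) auto
  qed
  then obtain u w where uw: "u \<le> n" "w \<le> n"
    "\<And>I. I \<in> \<J> \<Longrightarrow> prefix_count I u - prefix_count I w \<noteq> prefix_count K u - prefix_count K w"
    by fastforce
  then show False using agree'[OF uw(1,2)] by fastforce
qed

text \<open>
  The set \<open>M\<close> consists of one integer \<open>c\<close> or of two neighbours \<open>c\<close>, \<open>c + 1\<close>; the parabolas are
  \<open>(m - c)\<^sup>2\<close> and \<open>(m - c) (m - c - 1)\<close>.
\<close>
lemma integer_parabola:
  assumes "M \<noteq> {}" "\<And>x y. x \<in> M \<Longrightarrow> y \<in> M \<Longrightarrow> x \<le> y + (1::int)"
  obtains r s :: real where
    "\<And>m. 0 \<le> (of_int m)\<^sup>2 - of_int m + r * of_int m + s"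
    "\<And>m. (of_int m)\<^sup>2 - of_int m + r * of_int m + s = 0 \<longleftrightarrow> m \<in> M"
proof -
  obtain x where x: "x \<in> M" using assms(1) by blast
  obtain c where c: "M = {c} \<or> M = {c, c + 1}"
  proof (cases "M = {x}")
    case False
    then obtain y where y: "y \<in> M" "y \<noteq> x" using x by blast
    have "z = min x y \<or> z = min x y + 1" if "z \<in> M" for z
      using assms(2)[OF that x] assms(2)[OF x that] assms(2)[OF that y(1)] assms(2)[OF y(1) that]
        assms(2)[OF x y(1)] assms(2)[OF y(1) x] y(2) by linarith
    moreover have "min x y \<in> M" "min x y + 1 \<in> M"
      using x y assms(2)[OF x y(1)] assms(2)[OF y(1) x]
      by (auto simp: min_def) (metis add.commute add_le_imp_le_left antisym_conv2 int_one_le_iff_zero_less linorder_not_le order_antisym zle_add1_eq_le)+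
    ultimately have "M = {min x y, min x y + 1}" by blast
    then show thesis using that by blast
  qed (use that in blast)
  show thesis
  proof (cases "M = {c}")
    case True
    have eq: "(of_int m)\<^sup>2 - of_int m + (1 - 2 * of_int c) * of_int m + (of_int c)\<^sup>2 = (of_int (m - c) :: real)\<^sup>2" for m
      by (simp add: power2_eq_square algebra_simps)
    show thesis by (rule that[of "1 - 2 * of_int c" "(of_int c)\<^sup>2"]) (unfold eq, use True in auto)
  next
    case False
    then have M: "M = {c, c + 1}" using c by blast
    have eq: "(of_int m)\<^sup>2 - of_int m + (- 2 * of_int c) * of_int m + of_int (c * (c + 1)) =
        (of_int ((m - c) * (m - c - 1)) :: real)" for m
      by (simp add: power2_eq_square algebra_simps)
    have "0 \<le> (m - c) * (m - c - 1)" for m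
      by (cases "m \<le> c") (auto intro: mult_nonpos_nonpos mult_nonneg_nonneg)
    then show thesis
      by (intro that[of "- 2 * of_int c" "of_int (c * (c + 1))"])
         (unfold eq of_int_0_le_iff of_int_eq_0_iff, use M in auto)
  qed
qed

lemma two_card_pairs:
  fixes S :: "nat set"
  assumes "finite S"
  shows "2 * real (card {(i, j). i \<in> S \<and> j \<in> S \<and> i < j}) = (real (card S))\<^sup>2 - real (card S)"
  using assms
proof (induction S rule: finite_linorder_max_induct)
  case (insert b S)
  let ?P = "\<lambda>S. {(i, j). i \<in> S \<and> j \<in> S \<and> i < j}"
  have "?P (insert b S) = ?P S \<union> S \<times> {b}" using insert by auto
  moreover have "finite (?P S)" by (rule finite_subset[of _ "S \<times> S"]) (use insert in auto)
  moreover have "?P S \<inter> S \<times> {b} = {}" using insert by auto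
  ultimately have "card (?P (insert b S)) = card (?P S) + card S"
    using insert by (simp add: card_Un_disjoint card_cartesian_product)
  then show ?case using insert by (auto simp: power2_eq_square algebra_simps)
qed simp

text \<open>
  The weights are mixed second differences of \<open>(i, j) \<mapsto> - ln (j - i)\<close>.  Strict concavity of the
  logarithm makes them positive in the interior, and its monotonicity does so at the
  boundary.
\<close>
lemma log_distance_decomposition:
  obtains w :: "nat \<Rightarrow> nat \<Rightarrow> real" where
    "\<And>a b. a < b \<Longrightarrow> b \<le> n \<Longrightarrow> 0 < w a b"
    "\<And>i j. 1 \<le> i \<Longrightarrow> i < j \<Longrightarrow> j \<le> n \<Longrightarrow>
       ln (real j - real i) = ln (real n) - (\<Sum>(a, b)\<in>{..<i} \<times> {j..n}. w a b)"
proof -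
  \<comment> \<open>The value 0 outside the range of nodes stands for a distance \<open>n\<close>, which is at least
    every distance that occurs; it makes the telescoping sums end at 0.\<close>
  define E where "E = (\<lambda>i j. if i = 0 \<or> j = Suc n then 0 else ln (real n) - ln (real j - real i))"
  define \<mu> where "\<mu> = (\<lambda>a b. (E (Suc a) b - E a b) - (E (Suc a) (Suc b) - E a (Suc b)))"
  \<comment> \<open>Intervals of length 1 contain no pair, so their weight may be any positive number.\<close>
  define w where "w = (\<lambda>a b. if b = Suc a then 1 else \<mu> a b)"
  have pos: "0 < \<mu> a b" if ab: "Suc a < b" "b \<le> n" for a b
  proof -
    define d where "d = real b - real a"
    have d: "2 \<le> d" using ab by (simp add: d_def)
    have "(d - 1) * (d + 1) < d * d" by (simp add: algebra_simps)
    then have "ln ((d - 1) * (d + 1)) < ln (d * d)" using d by (intro ln_less_cancel_iff[THEN iffD2]) auto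
    then have "ln (d - 1) + ln (d + 1) < ln d + ln d" using d by (simp add: ln_mult)
    moreover have "ln (d - 1) < ln d" using d by simp
    moreover have "a = 0 \<Longrightarrow> b = n \<Longrightarrow> ln (d - 1) < ln (real n)" using d by (simp add: d_def)
    moreover have "E (Suc a) b = ln (real n) - ln (d - 1)"
      "E a b = (if a = 0 then 0 else ln (real n) - ln d)"
      "E (Suc a) (Suc b) = (if b = n then 0 else ln (real n) - ln d)"
      "E a (Suc b) = (if a = 0 \<or> b = n then 0 else ln (real n) - ln (d + 1))"
      using ab by (auto simp: E_def d_def algebra_simps)
    ultimately show ?thesis unfolding \<mu>_def by (cases "a = 0"; cases "b = n") auto
  qed
  show thesis
  proof (rule that[of w])
    show "0 < w a b" if "a < b" "b \<le> n" for a b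
      using that pos[of a b] by (auto simp: w_def)
    fix i j :: nat assume ij: "1 \<le> i" "i < j" "j \<le> n"
    have "(\<Sum>(a, b)\<in>{..<i} \<times> {j..n}. w a b) = (\<Sum>a<i. \<Sum>b=j..<Suc n. \<mu> a b)"
      unfolding sum.cartesian_product[symmetric] atLeastLessThanSuc_atLeastAtMost
      by (intro sum.cong refl) (use ij in \<open>auto simp: w_def\<close>)
    also have "\<dots> = (\<Sum>a<i. E (Suc a) j - E a j)"
    proof (rule sum.cong[OF refl])
      fix a
      have "(\<Sum>b=j..<Suc n. \<mu> a b) = - (\<Sum>b=j..<Suc n. (E (Suc a) (Suc b) - E a (Suc b)) - (E (Suc a) b - E a b))"
        unfolding \<mu>_def by (simp only: sum_negf[symmetric]) (simp add: algebra_simps)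
      also have "\<dots> = E (Suc a) j - E a j"
        by (subst sum_Suc_diff') (use ij in \<open>auto simp: E_def\<close>)
      finally show "(\<Sum>b=j..<Suc n. \<mu> a b) = E (Suc a) j - E a j" .
    qed
    also have "\<dots> = E i j" using sum_lessThan_telescope[of "\<lambda>a. E a j" i] by (simp add: E_def)
    finally show "ln (real j - real i) = ln (real n) - (\<Sum>(a, b)\<in>{..<i} \<times> {j..n}. w a b)"
      using ij by (simp add: E_def)
  qed
qed

text \<open>
  Each pair \<open>i < j\<close> of \<open>K\<close> meets the weight of every interval containing it; exchanging the sums, an
  interval is counted once for each pair inside it.
\<close>
lemma ln_prod_distances:
  assumes w: "\<And>i j. 1 \<le> i \<Longrightarrow> i < j \<Longrightarrow> j \<le> n \<Longrightarrow>
       ln (real j - real i) = ln (real n) - (\<Sum>(a, b)\<in>{..<i} \<times> {j..n}. w a b)"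
    and K: "K \<in> nsets {1..n} k"
  shows "ln (\<Prod>j\<in>K. \<Prod>i\<in>{i \<in> K. i < j}. real j - real i) =
    ((real k)\<^sup>2 - real k) / 2 * ln (real n) -
    (\<Sum>(a, b)\<in>{(a, b). a < b \<and> b \<le> n}. w a b / 2 *
        ((real (card (K \<inter> {a<..b})))\<^sup>2 - real (card (K \<inter> {a<..b}))))"
proof -
  let ?P = "\<lambda>S. {(i, j). i \<in> S \<and> j \<in> S \<and> i < j}"
  define Ivl where "Ivl = {(a, b). a < b \<and> b \<le> n}"
  have fin: "finite K" and sub: "K \<subseteq> {1..n}" and card: "card K = k"
    using K by (auto simp: nsets_def)
  have finI: "finite Ivl" by (rule finite_subset[of _ "{..n} \<times> {..n}"]) (auto simp: Ivl_def)
  have finP: "finite (?P S)" if "finite S" for S :: "nat set"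
    by (rule finite_subset[of _ "S \<times> S"]) (use that in auto)
  have "ln (\<Prod>j\<in>K. \<Prod>i\<in>{i \<in> K. i < j}. real j - real i) =
      (\<Sum>j\<in>K. ln (\<Prod>i\<in>{i \<in> K. i < j}. real j - real i))"
    by (rule ln_prod[OF fin]) (auto intro!: prod_pos)
  also have "\<dots> = (\<Sum>j\<in>K. \<Sum>i\<in>{i \<in> K. i < j}. ln (real j - real i))"
    by (intro sum.cong refl ln_prod) (use fin in auto)
  also have "\<dots> = (\<Sum>(j, i)\<in>(SIGMA j:K. {i \<in> K. i < j}). ln (real j - real i))"
    by (rule sum.Sigma) (use fin in auto)
  also have "\<dots> = (\<Sum>(i, j)\<in>?P K. ln (real j - real i))"
    by (rule sum.reindex_bij_witness[of _ "\<lambda>(i, j). (j, i)" "\<lambda>(i, j). (j, i)"]) auto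
  also have "\<dots> = (\<Sum>(i, j)\<in>?P K. ln (real n) - (\<Sum>(a, b)\<in>Ivl. if a < i \<and> j \<le> b then w a b else 0))"
  proof (intro sum.cong refl, clarify)
    fix i j assume ij: "i \<in> K" "j \<in> K" "i < j"
    have "(\<Sum>(a, b)\<in>Ivl. if a < i \<and> j \<le> b then w a b else 0) =
        (\<Sum>(a, b)\<in>{..<i} \<times> {j..n}. w a b)"
      by (rule sum.mono_neutral_cong_right[OF finI]) (use ij in \<open>auto simp: Ivl_def split: if_splits\<close>)
    then show "ln (real j - real i) = ln (real n) - (\<Sum>(a, b)\<in>Ivl. if a < i \<and> j \<le> b then w a b else 0)"
      using w[of i j] ij subsetD[OF sub, of i] subsetD[OF sub, of j] by simp
  qed
  also have "\<dots> = real (card (?P K)) * ln (real n) -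
      (\<Sum>(i, j)\<in>?P K. \<Sum>(a, b)\<in>Ivl. if a < i \<and> j \<le> b then w a b else 0)"
    by (simp add: case_prod_unfold sum_subtractf)
  also have "(\<Sum>(i, j)\<in>?P K. \<Sum>(a, b)\<in>Ivl. if a < i \<and> j \<le> b then w a b else 0) =
      (\<Sum>(a, b)\<in>Ivl. \<Sum>(i, j)\<in>?P K. if a < i \<and> j \<le> b then w a b else 0)"
    unfolding case_prod_unfold by (rule sum.swap)
  also have "\<dots> = (\<Sum>(a, b)\<in>Ivl. w a b / 2 *
        ((real (card (K \<inter> {a<..b})))\<^sup>2 - real (card (K \<inter> {a<..b}))))"
  proof (intro sum.cong refl, clarify)
    fix a b assume "(a, b) \<in> Ivl"
    have "(\<Sum>(i, j)\<in>?P K. if a < i \<and> j \<le> b then w a b else 0) = (\<Sum>(i, j)\<in>?P (K \<inter> {a<..b}). w a b)"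
      by (rule sum.mono_neutral_cong_right[OF finP[OF fin]]) (auto split: if_splits)
    also have "\<dots> = w a b / 2 * (2 * real (card (?P (K \<inter> {a<..b}))))"
      by (simp add: case_prod_unfold)
    also have "2 * real (card (?P (K \<inter> {a<..b}))) =
        (real (card (K \<inter> {a<..b})))\<^sup>2 - real (card (K \<inter> {a<..b}))"
      by (rule two_card_pairs) (use fin in simp)
    finally show "(\<Sum>(i, j)\<in>?P K. if a < i \<and> j \<le> b then w a b else 0) =
        w a b / 2 * ((real (card (K \<inter> {a<..b})))\<^sup>2 - real (card (K \<inter> {a<..b})))" .
  qed
  finally show ?thesis using two_card_pairs[OF fin] card by (simp add: Ivl_def)
qed

lemma prefix_count_diff:
  assumes "a \<le> b"
  shows "prefix_count K b - prefix_count K a = int (card (K \<inter> {a<..b}))"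
proof -
  have "K \<inter> {1..b} = (K \<inter> {1..a}) \<union> (K \<inter> {a<..b})" using assms by auto
  also have "card \<dots> = card (K \<inter> {1..a}) + card (K \<inter> {a<..b})" by (rule card_Un_disjoint) auto
  finally show ?thesis by (simp add: prefix_count_def)
qed

text \<open>
  Column scalings add a linear function of the indicator of \<open>K\<close>, in particular any linear
  combination of the interval counts.  This is used to complete the quadratic energy of every
  interval to the parabola that vanishes exactly on the counts occurring in \<open>\<J>\<close>.
\<close>
lemma sorted_family_selected_by_scaling:
  assumes \<J>: "\<J> \<subseteq> nsets {1..n} k" "\<J> \<noteq> {}" "sorted_family \<J>"
  obtains t :: "nat \<Rightarrow> real" and C where
    "\<And>I. I \<in> \<J> \<Longrightarrow> ln (plucker (scaled_vandermonde k n t) I) = C"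
    "\<And>K. K \<in> nsets {1..n} k - \<J> \<Longrightarrow> ln (plucker (scaled_vandermonde k n t) K) < C"
proof -
  obtain w :: "nat \<Rightarrow> nat \<Rightarrow> real" where
    w_pos: "\<And>a b. a < b \<Longrightarrow> b \<le> n \<Longrightarrow> 0 < w a b"
    and w: "\<And>i j. 1 \<le> i \<Longrightarrow> i < j \<Longrightarrow> j \<le> n \<Longrightarrow>
       ln (real j - real i) = ln (real n) - (\<Sum>(a, b)\<in>{..<i} \<times> {j..n}. w a b)"
    using log_distance_decomposition by blast
  define cnt where "cnt = (\<lambda>(K :: nat set) a b. int (card (K \<inter> {a<..b})))"
  have "\<exists>r s::real. (\<forall>m. 0 \<le> (of_int m)\<^sup>2 - of_int m + r * of_int m + s) \<and>
      (\<forall>m. (of_int m)\<^sup>2 - of_int m + r * of_int m + s = 0 \<longleftrightarrow> m \<in> (\<lambda>I. cnt I a b) ` \<J>)"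
    if ab: "a < b" "b \<le> n" for a b
  proof -
    have close: "x \<le> y + 1" if "x \<in> (\<lambda>I. cnt I a b) ` \<J>" "y \<in> (\<lambda>I. cnt I a b) ` \<J>" for x y
    proof -
      obtain I J where IJ: "I \<in> \<J>" "J \<in> \<J>" "x = cnt I a b" "y = cnt J a b" using \<open>x \<in> _\<close> \<open>y \<in> _\<close> by blast
      then have "I \<in> nsets {1..n} k" "J \<in> nsets {1..n} k" "sorted_sets I J"
        using \<J> by (blast, blast, simp add: sorted_family_def)
      then have "prefix_count I b - prefix_count J b \<le> prefix_count I a - prefix_count J a + 1"
        using sorted_sets_iff_oscillation[of I n k J] ab by simp
      then show ?thesis
        using prefix_count_diff[of a b I] prefix_count_diff[of a b J] ab IJ by (simp add: cnt_def)
    qed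
    show ?thesis
      by (rule integer_parabola[of "(\<lambda>I. cnt I a b) ` \<J>"]) (use \<J>(2) close in blast)+
  qed
  then obtain r s :: "nat \<Rightarrow> nat \<Rightarrow> real" where
    nonneg: "\<And>a b m. a < b \<Longrightarrow> b \<le> n \<Longrightarrow> 0 \<le> (of_int m)\<^sup>2 - of_int m + r a b * of_int m + s a b"
    and zero: "\<And>a b m. a < b \<Longrightarrow> b \<le> n \<Longrightarrow>
      (of_int m)\<^sup>2 - of_int m + r a b * of_int m + s a b = 0 \<longleftrightarrow> m \<in> (\<lambda>I. cnt I a b) ` \<J>"
    by metis
  define Ivl where "Ivl = {(a, b). a < b \<and> b \<le> n}"
  have finI: "finite Ivl" by (rule finite_subset[of _ "{..n} \<times> {..n}"]) (auto simp: Ivl_def)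
  define t where "t = (\<lambda>i. - (\<Sum>(a, b)\<in>Ivl. if a < i \<and> i \<le> b then w a b / 2 * r a b else 0))"
  define C where "C = ((real k)\<^sup>2 - real k) / 2 * ln (real n) + (\<Sum>(a, b)\<in>Ivl. w a b / 2 * s a b)"
  \<comment> \<open>The remaining energy of \<open>K\<close>, interval by interval.\<close>
  define pen where "pen = (\<lambda>K (a, b). w a b / 2 *
      ((of_int (cnt K a b))\<^sup>2 - of_int (cnt K a b) + r a b * of_int (cnt K a b) + s a b))"
  have formula: "ln (plucker (scaled_vandermonde k n t) K) = C - sum (pen K) Ivl"
    if K: "K \<in> nsets {1..n} k" for K
  proof -
    have fin: "finite K" using K by (simp add: nsets_def)
    have "(\<Sum>i\<in>K. t i) = - (\<Sum>(a, b)\<in>Ivl. \<Sum>i\<in>K. if a < i \<and> i \<le> b then w a b / 2 * r a b else 0)"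
      unfolding t_def sum_negf case_prod_unfold by (subst sum.swap) simp
    also have "\<dots> = - (\<Sum>(a, b)\<in>Ivl. w a b / 2 * (r a b * of_int (cnt K a b)))"
    proof -
      have eq: "(\<Sum>i\<in>K. if a < i \<and> i \<le> b then w a b / 2 * r a b else 0) =
          w a b / 2 * (r a b * of_int (cnt K a b))" for a b
      proof -
        have "(\<Sum>i\<in>K. if a < i \<and> i \<le> b then w a b / 2 * r a b else 0) =
            (\<Sum>i\<in>K \<inter> {a<..b}. w a b / 2 * r a b)"
          by (rule sum.mono_neutral_cong_right[OF fin]) auto
        then show ?thesis by (simp add: cnt_def)
      qed
      show ?thesis by (simp only: eq)
    qed
    finally have t: "(\<Sum>i\<in>K. t i) = - (\<Sum>(a, b)\<in>Ivl. w a b / 2 * (r a b * of_int (cnt K a b)))" .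
    have L: "ln (\<Prod>j\<in>K. \<Prod>i\<in>{i \<in> K. i < j}. real j - real i) = ((real k)\<^sup>2 - real k) / 2 * ln (real n) -
        (\<Sum>(a, b)\<in>Ivl. w a b / 2 * ((of_int (cnt K a b))\<^sup>2 - of_int (cnt K a b)))"
      unfolding Ivl_def cnt_def of_int_of_nat_eq by (rule ln_prod_distances[OF w K])
    have "0 < (\<Prod>j\<in>K. \<Prod>i\<in>{i \<in> K. i < j}. real j - real i)"
      by (auto intro!: prod_pos)
    then have "ln (plucker (scaled_vandermonde k n t) K) =
        (\<Sum>i\<in>K. t i) + ln (\<Prod>j\<in>K. \<Prod>i\<in>{i \<in> K. i < j}. real j - real i)"
      unfolding plucker_scaled_vandermonde[OF K]
      by (subst ln_mult) auto
    also have "\<dots> = C - sum (pen K) Ivl"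
      unfolding t L C_def pen_def
      by (simp add: case_prod_unfold sum.distrib sum_subtractf algebra_simps sum_divide_distrib)
    finally show ?thesis .
  qed
  have pen_nonneg: "0 \<le> pen K ab" if "ab \<in> Ivl" for K ab
  proof -
    obtain a b where ab: "ab = (a, b)" "a < b" "b \<le> n"
      using \<open>ab \<in> Ivl\<close> by (cases ab) (auto simp: Ivl_def)
    show ?thesis
      unfolding pen_def ab(1) prod.case
      using w_pos[OF ab(2,3)] nonneg[OF ab(2,3)] by (intro mult_nonneg_nonneg) auto
  qed
  show thesis
  proof (rule that[of t C])
    fix I assume I: "I \<in> \<J>"
    have "pen I ab = 0" if "ab \<in> Ivl" for ab
      using that zero I by (auto simp: Ivl_def pen_def)
    then have "sum (pen I) Ivl = 0" by simp
    moreover have "I \<in> nsets {1..n} k" using I \<J>(1) by blast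
    ultimately show "ln (plucker (scaled_vandermonde k n t) I) = C" using formula by simp
  next
    fix K assume K: "K \<in> nsets {1..n} k - \<J>"
    have "\<not> (\<forall>a b. a < b \<longrightarrow> b \<le> n \<longrightarrow> (\<exists>I\<in>\<J>. prefix_count K b - prefix_count K a = prefix_count I b - prefix_count I a))"
      using sorted_family_interval_closed[OF \<J>, of K] K by blast
    then obtain a b where ab: "a < b" "b \<le> n"
      and ne: "\<And>I. I \<in> \<J> \<Longrightarrow> prefix_count K b - prefix_count K a \<noteq> prefix_count I b - prefix_count I a"
      by blast
    have "cnt K a b \<notin> (\<lambda>I. cnt I a b) ` \<J>"
      using ne prefix_count_diff[of a b] ab by (auto simp: cnt_def)
    then have "0 < pen K (a, b)"
      using zero[OF ab, of "cnt K a b"] nonneg[OF ab, of "cnt K a b"] w_pos[OF ab]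
      by (simp add: pen_def)
    then have "0 < sum (pen K) Ivl"
      using ab pen_nonneg by (intro sum_pos2[OF finI, of "(a, b)"]) (auto simp: Ivl_def)
    then show "ln (plucker (scaled_vandermonde k n t) K) < C" using formula K by simp
  qed
qed

section \<open>Maximal sorted families have n members\<close>

definition maximal_sorted_family :: "nat \<Rightarrow> nat \<Rightarrow> nat set set \<Rightarrow> bool" where
  "maximal_sorted_family n k \<J> \<longleftrightarrow>
     \<J> \<noteq> {} \<and> \<J> \<subseteq> nsets {1..n} k \<and> sorted_family \<J> \<and>
     (\<forall>\<J>'. \<J>' \<subseteq> nsets {1..n} k \<and> sorted_family \<J>' \<and> \<J> \<subseteq> \<J>' \<longrightarrow> \<J>' = \<J>)"

lemma sorted_sets_refl: "finite I \<Longrightarrow> sorted_sets I I"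
  by (simp add: sorted_sets_def interlaced_def)

lemma sorted_sets_sym: "sorted_sets I J \<Longrightarrow> sorted_sets J I"
  by (auto simp: sorted_sets_def)

context height_functions
begin

text \<open>
  The area under one period of a path strictly refines the order of paths; it serves as the rank of
  a member in a chain.
\<close>
definition area :: "(int \<Rightarrow> int) \<Rightarrow> int" where
  "area h = (\<Sum>x\<in>{1..int n}. h x)"

lemma area_eq_imp_eq:
  assumes "height g" "height h" "\<And>x. g x \<le> h x" "area h \<le> area g"
  shows "g = h"
proof (rule heights_eq_on_period[OF assms(1,2)], rule ccontr)
  fix x assume x: "x \<in> {1..int n}" "g x \<noteq> h x"
  have "area g < area h"
    unfolding area_def
    by (rule sum_strict_mono_ex1) (use assms(3) x in \<open>auto intro!: bexI[of _ x] simp: order.strict_iff_order\<close>)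
  then show False using assms(4) by simp
qed

lemma area_add_const: "area (\<lambda>x. h x + c) = area h + int n * c"
  by (simp add: area_def sum.distrib)

lemma area_bump:
  assumes "z \<in> {1..int n}"
  shows "area (bump z h) = area h + 1"
proof -
  have "area (bump z h) = (\<Sum>x\<in>{1..int n}. h x + (if x = z then 1 else 0))"
    unfolding area_def bump_def by (rule sum.cong) (use period_dvd_iff[OF _ assms] in auto)
  then show ?thesis using assms by (simp add: area_def sum.distrib)
qed

lemma area_height_of:
  assumes "I \<in> nsets {1..n} k"
  shows "area (height_of I) = (\<Sum>x\<in>{1..n}. prefix_count I x)"
  unfolding area_def
  by (rule sum.reindex_bij_witness[of _ int nat])
     (auto simp: nat_le_iff height_of_eq_prefix_count[OF assms, symmetric])

lemma height_of_steps:
  assumes "height h"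
  shows "height_of (steps h) = (\<lambda>x. h x - h 0)"
proof (rule heights_eq_on_period)
  show "height (height_of (steps h))" by (rule height_height_of[OF steps_in_nsets[OF assms]])
  show "height (\<lambda>x. h x - h 0)" using height_add_const[OF assms, of "- h 0"] by simp
  fix x assume "x \<in> {1..int n}"
  then have "x = int (nat x)" "nat x \<le> n" by auto
  then show "height_of (steps h) x = h x - h 0"
    using height_of_eq_prefix_count[OF steps_in_nsets[OF assms], of "nat x"]
      prefix_count_steps[OF assms, of "nat x"] by simp
qed

lemma height_of_le_add:
  assumes "I \<in> nsets {1..n} k" "J \<in> nsets {1..n} k" "\<And>x. prefix_count I x \<le> prefix_count J x + c"
  shows "height_of I x \<le> height_of J x + c"
  using assms(3) by (simp add: height_of_def add.assoc)

lemma height_of_sorted: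
  assumes "sorted_sets I J" "I \<in> nsets {1..n} k" "J \<in> nsets {1..n} k"
  shows "height_of I x \<le> height_of J x + 1"
    and "area (height_of I) \<le> area (height_of J) \<Longrightarrow> height_of I x \<le> height_of J x"
proof -
  show "height_of I x \<le> height_of J x + 1"
    by (rule height_of_le_add) (use assms sorted_setsD(2)[OF assms] in auto)
  assume le: "area (height_of I) \<le> area (height_of J)"
  have "prefix_count I \<le> prefix_count J \<or> prefix_count J \<le> prefix_count I"
    by (rule sorted_setsD(1)[OF assms])
  then show "height_of I x \<le> height_of J x"
  proof
    assume "prefix_count J \<le> prefix_count I"
    then have "\<And>x. height_of J x \<le> height_of I x"
      using height_of_le_add[OF assms(3,2), of 0] by (simp add: le_fun_def)
    then have "height_of J = height_of I"
      using area_eq_imp_eq[OF height_height_of[OF assms(3)] height_height_of[OF assms(2)]] le by blast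
    then show ?thesis by simp
  qed (use height_of_le_add[OF assms(2,3), of 0] in \<open>simp add: le_fun_def\<close>)
qed

lemma area_sorted_inject:
  assumes "sorted_sets I J" "I \<in> nsets {1..n} k" "J \<in> nsets {1..n} k"
    "area (height_of I) = area (height_of J)"
  shows "I = J"
proof -
  have "height_of I = height_of J"
    by (rule area_eq_imp_eq[OF height_height_of[OF assms(2)] height_height_of[OF assms(3)]
          height_of_sorted(2)[OF assms(1-3)]]) (use assms(4) in simp_all)
  then show ?thesis using steps_height_of[OF assms(2)] steps_height_of[OF assms(3)] by metis
qed

text \<open>
  Paths of sorted sets differ by at most 1 at each of the \<open>n\<close> points of a period, and not at all at
  the point \<open>n\<close>.
\<close>
lemma area_sorted_less:
  assumes "sorted_sets I J" "I \<in> nsets {1..n} k" "J \<in> nsets {1..n} k"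
  shows "area (height_of I) < area (height_of J) + int n"
proof -
  have "(\<Sum>x\<in>{1..int n}. height_of I x) < (\<Sum>x\<in>{1..int n}. height_of J x + 1)"
  proof (rule sum_strict_mono_ex1)
    have "height_of I (int n) < height_of J (int n) + 1"
      using height_of_eq_prefix_count[OF assms(2), of n] height_of_eq_prefix_count[OF assms(3), of n]
        prefix_count_full[OF assms(2), of n] prefix_count_full[OF assms(3), of n] by simp
    then show "\<exists>x\<in>{1..int n}. height_of I x < height_of J x + 1"
      using k_less by (intro bexI[of _ "int n"]) auto
  qed (use height_of_sorted(1)[OF assms] in auto)
  then show ?thesis by (simp add: area_def sum.distrib)
qed

lemma finite_family: "\<J> \<subseteq> nsets {1..n} k \<Longrightarrow> finite \<J>"
  using finite_imp_finite_nsets[of "{1..n}" k] by (auto intro: finite_subset)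

lemma sorted_family_area:
  assumes \<J>: "\<J> \<subseteq> nsets {1..n} k" "sorted_family \<J>" "\<J> \<noteq> {}"
  obtains T where "T \<in> \<J>"
    "(\<lambda>I. area (height_of I)) ` \<J> \<subseteq> {area (height_of T) - int n + 1..area (height_of T)}"
    "inj_on (\<lambda>I. area (height_of I)) \<J>"
proof -
  let ?a = "\<lambda>I. area (height_of I)"
  have fin: "finite (?a ` \<J>)" using finite_family[OF \<J>(1)] by simp
  then obtain T where T: "T \<in> \<J>" "?a T = Max (?a ` \<J>)"
    using Max_in[OF fin] \<J>(3) by (metis (no_types, lifting) image_iff image_is_empty)
  have "?a I \<in> {?a T - int n + 1..?a T}" if I: "I \<in> \<J>" for I
  proof -
    have "?a I \<le> ?a T" using T(2) fin I by simp
    moreover have "?a T < ?a I + int n"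
      by (rule area_sorted_less) (use \<J> T(1) I in \<open>auto simp: sorted_family_def\<close>)
    ultimately show ?thesis by auto
  qed
  moreover have "inj_on ?a \<J>"
    using area_sorted_inject \<J>(1,2) unfolding inj_on_def sorted_family_def by blast
  ultimately show thesis using that[OF T(1)] by blast
qed

lemma card_sorted_family_le:
  assumes "\<J> \<subseteq> nsets {1..n} k" "sorted_family \<J>"
  shows "card \<J> \<le> n"
proof (cases "\<J> = {}")
  case False
  then obtain T where T: "(\<lambda>I. area (height_of I)) ` \<J> \<subseteq> {area (height_of T) - int n + 1..area (height_of T)}"
    "inj_on (\<lambda>I. area (height_of I)) \<J>" using sorted_family_area[OF assms] by metis
  have "card \<J> \<le> card {area (height_of T) - int n + 1..area (height_of T)}"
    by (rule card_inj_on_le[OF T(2,1)]) simp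
  then show ?thesis by simp
qed simp

text \<open>
  A gap in the areas can be filled.  If the area \<open>v\<close> is missing, the path of area \<open>v - 1\<close> is either
  that of a member or the top path lowered by 1; raising it at one point, below the next higher
  member, gives a path of area \<open>v\<close> that is sorted with the whole family.
\<close>
lemma maximal_sorted_family_areas:
  assumes "maximal_sorted_family n k \<J>"
  obtains T where "T \<in> \<J>"
    "(\<lambda>I. area (height_of I)) ` \<J> = {area (height_of T) - int n + 1..area (height_of T)}"
    "inj_on (\<lambda>I. area (height_of I)) \<J>"
proof -
  let ?a = "\<lambda>I. area (height_of I)"
  have \<J>: "\<J> \<subseteq> nsets {1..n} k" "sorted_family \<J>" "\<J> \<noteq> {}"
    using assms by (auto simp: maximal_sorted_family_def)
  obtain T where T: "T \<in> \<J>" and areas: "?a ` \<J> \<subseteq> {?a T - int n + 1..?a T}" and inj: "inj_on ?a \<J>"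
    using sorted_family_area[OF \<J>] by metis
  have sub: "I \<in> nsets {1..n} k" if "I \<in> \<J>" for I using that \<J>(1) by blast
  have sorted: "sorted_sets I J" if "I \<in> \<J>" "J \<in> \<J>" for I J
    using \<J>(2) that by (simp add: sorted_family_def)
  have le: "height_of I x \<le> height_of J x" if "I \<in> \<J>" "J \<in> \<J>" "?a I \<le> ?a J" for I J x
    using height_of_sorted(2)[OF sorted sub sub] that by blast
  have le1: "height_of I x \<le> height_of J x + 1" if "I \<in> \<J>" "J \<in> \<J>" for I J x
    using height_of_sorted(1)[OF sorted sub sub] that by blast
  have "?a ` \<J> = {?a T - int n + 1..?a T}"
  proof (rule ccontr)
    assume "?a ` \<J> \<noteq> {?a T - int n + 1..?a T}"
    define G where "G = {v \<in> {?a T - int n + 1..?a T}. v \<notin> ?a ` \<J>}"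
    have G: "finite G" "G \<noteq> {}"
      using \<open>?a ` \<J> \<noteq> _\<close> areas by (auto simp: G_def intro: finite_subset[of _ "{?a T - int n + 1..?a T}"])
    \<comment> \<open>With the least missing area \<open>v\<close>, the area \<open>v - 1\<close> is available: it
      belongs to a member, or it is that of the translated top path.\<close>
    define v where "v = Min G"
    have v: "v \<in> G" and v_min: "\<And>u. u \<in> G \<Longrightarrow> v \<le> u" using G by (simp_all add: v_def)
    have vT: "?a T - int n < v" "v < ?a T" using v T by (auto simp: G_def order.strict_iff_order)
    obtain P where P: "P \<in> \<J>" "v < ?a P" and P_min: "\<And>I. I \<in> \<J> \<Longrightarrow> v < ?a I \<Longrightarrow> ?a P \<le> ?a I"
    proof -
      define A where "A = {I \<in> \<J>. v < ?a I}"
      have "finite A" "A \<noteq> {}" using finite_family[OF \<J>(1)] T vT by (auto simp: A_def)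
      then have "arg_min_on ?a A \<in> A" "\<And>I. I \<in> A \<Longrightarrow> ?a (arg_min_on ?a A) \<le> ?a I"
        using arg_min_if_finite[of A ?a] by (auto simp: not_less)
      then show thesis using that[of "arg_min_on ?a A"] by (simp add: A_def)
    qed
    obtain g where g: "height g" "area g = v - 1" "\<And>x. g x \<le> height_of P x"
      and above: "\<And>I x. I \<in> \<J> \<Longrightarrow> height_of I x \<le> g x + 1"
      and below: "\<And>I x. I \<in> \<J> \<Longrightarrow> ?a I < v \<Longrightarrow> height_of I x \<le> g x"
    proof (cases "v - 1 \<in> ?a ` \<J>")
      case True
      then obtain Q where Q: "Q \<in> \<J>" "?a Q = v - 1" by auto
      show thesis
        by (rule that[of "height_of Q"])
           (use Q P le le1 height_height_of[OF sub] in \<open>auto intro!: le\<close>)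
    next
      case False
      have "v - 1 \<notin> G" using v_min[of "v - 1"] by auto
      then have v_eq: "v - 1 = ?a T - int n" using False vT v by (auto simp: G_def)
      show thesis
      proof (rule that[of "\<lambda>x. height_of T x + (- 1)"])
        show "height (\<lambda>x. height_of T x + (- 1))" by (rule height_add_const[OF height_height_of[OF sub[OF T]]])
        show "area (\<lambda>x. height_of T x + (- 1)) = v - 1" unfolding area_add_const using v_eq by simp
        show "height_of T x + - 1 \<le> height_of P x" for x using le1[OF T P(1), of x] by simp
        show "height_of I x \<le> height_of T x + - 1 + 1" if "I \<in> \<J>" for I x
          using le[OF that T, of x] areas that by auto
        show "height_of I x \<le> height_of T x + - 1" if "I \<in> \<J>" "?a I < v" for I x
          using that v_eq areas by auto
      qed
    qed
    have "g \<noteq> height_of P" using g(2) P(2) by auto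
    then obtain z where z: "z \<in> {1..int n}" "height (bump z g)" "\<And>x. bump z g x \<le> height_of P x"
      using bump_between[OF g(1) height_height_of[OF sub[OF P(1)]] g(3)] by metis
    define \<kappa> where "\<kappa> = bump z g"
    have \<kappa>: "height \<kappa>" "area \<kappa> = v" "\<And>x. g x \<le> \<kappa> x" "\<And>x. \<kappa> x \<le> height_of P x"
      using z area_bump[OF z(1)] g(2) by (auto simp: \<kappa>_def bump_def)
    define K where "K = steps \<kappa>"
    have K: "K \<in> nsets {1..n} k" unfolding K_def by (rule steps_in_nsets[OF \<kappa>(1)])
    have hK: "height_of K = (\<lambda>x. \<kappa> x - \<kappa> 0)" unfolding K_def by (rule height_of_steps[OF \<kappa>(1)])
    have K_sorted: "sorted_sets K I" if I: "I \<in> \<J>" for I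
    proof -
      define D where "D = (\<lambda>x. \<kappa> x - height_of I x)"
      have "(\<forall>x. - 1 \<le> D x \<and> D x \<le> 0) \<or> (\<forall>x. 0 \<le> D x \<and> D x \<le> 1)"
      proof (cases "?a I < v")
        case True
        then have "0 \<le> D x \<and> D x \<le> 1" for x
          using below[OF I True, of x] \<kappa>(3,4)[of x] le1[OF P(1) I, of x] by (simp add: D_def)
        then show ?thesis by blast
      next
        case False
        moreover have "?a I \<noteq> v" using v I by (auto simp: G_def)
        ultimately have "?a P \<le> ?a I" using P_min[OF I] by simp
        then have "- 1 \<le> D x \<and> D x \<le> 0" for x
          using le[OF P(1) I, of x] \<kappa>(3,4)[of x] above[OF I, of x] by (simp add: D_def)
        then show ?thesis by blast
      qed
      then have "D u \<le> D w + 1" for u w by (smt (verit))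
      moreover have "prefix_count K x - prefix_count I x = D (int x) - \<kappa> 0" if "x \<le> n" for x
        using height_of_eq_prefix_count[OF K that] height_of_eq_prefix_count[OF sub[OF I] that]
        by (simp add: D_def hK)
      ultimately show ?thesis unfolding sorted_sets_iff_oscillation[OF K sub[OF I]] by simp
    qed
    have "sorted_family (insert K \<J>)"
    proof (unfold sorted_family_def, intro ballI)
      fix I J assume "I \<in> insert K \<J>" "J \<in> insert K \<J>"
      moreover have "finite K" using K by (simp add: nsets_def)
      ultimately show "sorted_sets I J"
        using K_sorted sorted sorted_sets_sym[OF K_sorted] sorted_sets_refl[of K] by auto
    qed
    then have "insert K \<J> = \<J>"
      using assms K \<J>(1) unfolding maximal_sorted_family_def
      by (elim conjE allE[of _ "insert K \<J>"]) auto
    then have "K \<in> \<J>" by blast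
    \<comment> \<open>A bump at the point \<open>n\<close> also raises the path at 0, and normalising it changes the
      area by \<open>n\<close>.  Areas in an interval of length \<open>n\<close> cannot be congruent
      unless they are equal, so \<open>K\<close> is new in any case.\<close>
    have aK: "?a K = v - int n * \<kappa> 0"
      unfolding hK using area_add_const[of \<kappa> "- \<kappa> 0"] \<kappa>(2) by simp
    have "?a T - int n + 1 \<le> ?a K" "?a K \<le> ?a T" using areas \<open>K \<in> \<J>\<close> by auto
    then have "int n * \<kappa> 0 < int n * 1" "int n * (- 1) < int n * \<kappa> 0"
      using aK vT by linarith+
    then have "\<kappa> 0 < 1" "- 1 < \<kappa> 0"
      using k_less by (simp_all only: mult_less_cancel_left_pos of_nat_0_less_iff less_trans[OF k_pos])
    then have "\<kappa> 0 = 0" by simp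
    then show False using aK \<open>K \<in> \<J>\<close> v by (auto simp: G_def)
  qed
  then show thesis using that[OF T _ inj] by blast
qed

lemma card_maximal_sorted_family:
  assumes "maximal_sorted_family n k \<J>"
  shows "card \<J> = n"
proof -
  obtain T where T: "(\<lambda>I. area (height_of I)) ` \<J> = {area (height_of T) - int n + 1..area (height_of T)}"
    "inj_on (\<lambda>I. area (height_of I)) \<J>" using maximal_sorted_family_areas[OF assms] by metis
  have "card \<J> = card {area (height_of T) - int n + 1..area (height_of T)}"
    using card_image[OF T(2)] T(1) by simp
  then show ?thesis by simp
qed

end

section \<open>Maximal sorted families and permutations\<close>

context height_functions
begin

text \<open>
  The time at which the point \<open>x\<close> of the path drops by 1.  The end points 0 and \<open>n\<close> never drop before
  time \<open>n\<close>; a permutation of \<open>{1..n - 1}\<close> fixes \<open>n\<close>, so only 0 needs a convention.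
\<close>
definition departure :: "(nat \<Rightarrow> nat) \<Rightarrow> nat \<Rightarrow> nat" where
  "departure v x = (if x = 0 then n else v x)"

text \<open>
  The set at time \<open>t\<close> of the chain given by \<open>v\<close>: the step at \<open>x\<close> goes up initially iff \<open>x\<close> departs
  before \<open>x - 1\<close>, and it is flipped during the time between the two departures.
\<close>
definition chain_set :: "(nat \<Rightarrow> nat) \<Rightarrow> nat \<Rightarrow> nat set" where
  "chain_set v t = {x \<in> {1..n}.
     if departure v x < departure v (x - 1) then \<not> (departure v x \<le> t \<and> t < departure v (x - 1))
     else departure v (x - 1) \<le> t \<and> t < departure v x}"

definition descent_tops :: "(nat \<Rightarrow> nat) \<Rightarrow> nat set" where
  "descent_tops v = {x \<in> {1..n}. departure v x < departure v (x - 1)}"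

text \<open>
  The step into a point differs from that of the top path just while exactly one of its two ends has
  departed, so flipping these steps lowers the departed points by 1 and leaves the others alone.
\<close>
lemma prefix_count_chain_set:
  assumes "t < n" "x \<le> n"
  shows "prefix_count (chain_set v t) x =
         prefix_count (descent_tops v) x - (if departure v x \<le> t then 1 else 0)"
  using assms(2)
proof (induction x)
  case 0
  then show ?case using assms(1) by (simp add: departure_def)
next
  case (Suc x)
  then show ?case
    by (auto simp: prefix_count_Suc chain_set_def descent_tops_def)
qed

text \<open>
  The elements of the top set are 1, since the point 0 departs last, and the positions following a
  descent; the point \<open>n\<close> departs last as well and adds nothing.
\<close>
lemma card_descent_tops:
  assumes v: "v permutes {1..n - 1}"
  shows "card (descent_tops v) = Suc (card (descents (n - 1) v))"
proof -
  have n: "2 \<le> n" using k_pos k_less by simp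
  have vn: "v n = n" using permutes_not_in[OF v, of n] n by auto
  have less: "v x < n" if "x \<in> {1..n - 1}" for x
    using permutes_in_image[OF v, of x] that n by auto
  have "descent_tops v = insert 1 (Suc ` descents (n - 1) v)"
  proof (rule Set.set_eqI)
    fix x
    consider "x = 0" | "x = 1" | "2 \<le> x" "x \<le> n - 1" | "x = n" "2 \<le> x" | "n < x" by linarith
    then show "x \<in> descent_tops v \<longleftrightarrow> x \<in> insert 1 (Suc ` descents (n - 1) v)"
    proof cases
      case 2
      then show ?thesis using less[of 1] n by (simp add: descent_tops_def departure_def)
    next
      case 3
      then obtain y where "x = Suc y" "1 \<le> y" by (cases x) auto
      then show ?thesis using 3 by (auto simp: descent_tops_def departure_def descents_def)
    next
      case 4
      have "v (n - 1) < n" by (rule less) (use n in auto)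
      then show ?thesis using 4 n vn
        by (auto simp: descent_tops_def departure_def descents_def)
    qed (use n in \<open>auto simp: descent_tops_def descents_def\<close>)
  qed
  moreover have "1 \<notin> Suc ` descents (n - 1) v" "finite (descents (n - 1) v)"
    by (auto simp: descents_def)
  ultimately show ?thesis by (simp add: card_image)
qed

definition chain :: "(nat \<Rightarrow> nat) \<Rightarrow> nat set set" where
  "chain v = chain_set v ` {..<n}"

text \<open>
  Recovers the departure times from a chain: \<open>x\<close> has not dropped yet in those members whose path is
  highest at \<open>x\<close>.
\<close>
definition departure_of :: "nat set set \<Rightarrow> nat \<Rightarrow> nat" where
  "departure_of \<J> x = card {I \<in> \<J>. \<forall>J\<in>\<J>. prefix_count J x \<le> prefix_count I x}"

context
  fixes v :: "nat \<Rightarrow> nat"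
  assumes v: "v permutes {1..n - 1}" and desc: "Suc (card (descents (n - 1) v)) = k"
begin

lemma chain_set_in_nsets:
  assumes "t < n"
  shows "chain_set v t \<in> nsets {1..n} k"
proof -
  have "v n = n" using permutes_not_in[OF v, of n] k_less by auto
  then have "prefix_count (chain_set v t) n = prefix_count (descent_tops v) n"
    using prefix_count_chain_set[OF assms order_refl] assms by (simp add: departure_def)
  moreover have "chain_set v t \<inter> {1..n} = chain_set v t" "descent_tops v \<inter> {1..n} = descent_tops v"
    by (auto simp: chain_set_def descent_tops_def)
  ultimately have "card (chain_set v t) = k"
    using card_descent_tops[OF v] desc by (simp add: prefix_count_def)
  then show ?thesis by (auto simp: nsets_def chain_set_def)
qed

lemma inj_on_chain_set: "inj_on (chain_set v) {..<n}"
proof (rule linorder_inj_onI)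
  fix s t assume st: "s < t" "s \<in> {..<n}" "t \<in> {..<n}"
  then have "t \<in> v ` {1..n - 1}" using permutes_image[OF v] by auto
  then obtain x where x: "x \<in> {1..n - 1}" "v x = t" by auto
  have "prefix_count (chain_set v s) x \<noteq> prefix_count (chain_set v t) x"
    using x st by (auto simp: prefix_count_chain_set departure_def)
  then show "chain_set v s \<noteq> chain_set v t" by auto
qed auto

text \<open>
  The paths at successive times are nested and there are \<open>n\<close> of them, which no sorted family can exceed.
\<close>
lemma maximal_sorted_family_chain: "maximal_sorted_family n k (chain v)"
proof -
  have sub: "chain v \<subseteq> nsets {1..n} k" using chain_set_in_nsets by (auto simp: chain_def)
  have ord: "sorted_sets (chain_set v s) (chain_set v t)" if "s \<le> t" "t < n" for s t
    unfolding sorted_sets_iff_oscillation[OF chain_set_in_nsets[OF le_less_trans[OF that]] chain_set_in_nsets[OF that(2)]]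
    using that by (simp add: prefix_count_chain_set)
  have "sorted_family (chain v)"
    unfolding sorted_family_def chain_def
  proof (intro ballI, clarify)
    fix s t assume "s < n" "t < n"
    then show "sorted_sets (chain_set v s) (chain_set v t)"
      using ord[of s t] ord[of t s] sorted_sets_sym by (cases "s \<le> t") auto
  qed
  moreover have card: "card (chain v) = n" using card_image[OF inj_on_chain_set] by (simp add: chain_def)
  moreover have "\<J>' = chain v" if "\<J>' \<subseteq> nsets {1..n} k" "sorted_family \<J>'" "chain v \<subseteq> \<J>'" for \<J>'
    using card_subset_eq[OF finite_family[OF that(1)] that(3)] card_mono[OF finite_family[OF that(1)] that(3)]
      card_sorted_family_le[OF that(1,2)] card by simp
  ultimately show ?thesis
    using sub k_less unfolding maximal_sorted_family_def by (auto simp: chain_def)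
qed

lemma departure_of_chain:
  assumes x: "x \<in> {1..n - 1}"
  shows "departure_of (chain v) x = v x"
proof -
  have vx: "1 \<le> v x" "v x \<le> n" using permutes_in_image[OF v, of x] x by auto
  have pc: "prefix_count (chain_set v t) x = prefix_count (descent_tops v) x - (if v x \<le> t then 1 else 0)"
    if "t < n" for t proof -
    have "x \<le> n" "x \<noteq> 0" using x by auto
    then show ?thesis using prefix_count_chain_set[OF that, of x v] by (simp add: departure_def)
  qed
  have n: "0 < n" using k_less by simp
  have "(\<forall>J\<in>chain v. prefix_count J x \<le> prefix_count (chain_set v t) x) \<longleftrightarrow> t < v x" if t: "t < n" for t
  proof
    assume "\<forall>J\<in>chain v. prefix_count J x \<le> prefix_count (chain_set v t) x"
    then have "prefix_count (chain_set v 0) x \<le> prefix_count (chain_set v t) x" using n by (auto simp: chain_def)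
    then show "t < v x" using pc[OF t] pc[OF n] vx by (auto split: if_splits)
  qed (use pc t in \<open>auto simp: chain_def\<close>)
  then have "{I \<in> chain v. \<forall>J\<in>chain v. prefix_count J x \<le> prefix_count I x} =
      chain_set v ` {t \<in> {..<n}. t < v x}"
    by (auto simp: chain_def[of v])
  also have "{t \<in> {..<n}. t < v x} = {..<v x}" using vx by auto
  finally show ?thesis
    unfolding departure_of_def
    using card_image[OF inj_on_subset[OF inj_on_chain_set, of "{..<v x}"]] vx by simp
qed

end

lemma inj_on_chain: "inj_on chain {v. v permutes {1..n - 1} \<and> Suc (card (descents (n - 1) v)) = k}"
proof (rule inj_onI)
  fix v w
  assume "v \<in> {v. v permutes {1..n - 1} \<and> Suc (card (descents (n - 1) v)) = k}"
    and "w \<in> {v. v permutes {1..n - 1} \<and> Suc (card (descents (n - 1) v)) = k}"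
    and eq: "chain v = chain w"
  then have v: "v permutes {1..n - 1}" "Suc (card (descents (n - 1) v)) = k"
    and w: "w permutes {1..n - 1}" "Suc (card (descents (n - 1) w)) = k" by auto
  show "v = w"
  proof
    fix x
    show "v x = w x"
      using departure_of_chain[OF v, of x] departure_of_chain[OF w, of x] eq
        permutes_not_in[OF v(1), of x] permutes_not_in[OF w(1), of x] by (cases "x \<in> {1..n - 1}") auto
  qed
qed

text \<open>
  Listing the members by decreasing area, each path arises from the preceding one by lowering a
  single point, since the areas are consecutive.  The resulting order of the points is the
  permutation, and comparing the departures of \<open>x - 1\<close> and \<open>x\<close> reveals whether the top path steps up
  at \<open>x\<close>: otherwise the step would leave \<open>{0, 1}\<close> in between.
\<close>
lemma maximal_sorted_family_eq_chain:
  assumes max: "maximal_sorted_family n k \<J>"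
  obtains v where "v permutes {1..n - 1}" "Suc (card (descents (n - 1) v)) = k" "\<J> = chain v"
proof -
  let ?a = "\<lambda>I. area (height_of I)"
  have \<J>: "\<J> \<subseteq> nsets {1..n} k" "sorted_family \<J>" "\<J> \<noteq> {}"
    using max by (auto simp: maximal_sorted_family_def)
  obtain T where T: "T \<in> \<J>" and areas: "?a ` \<J> = {?a T - int n + 1..?a T}" and inj: "inj_on ?a \<J>"
    using maximal_sorted_family_areas[OF max] by metis
  have n: "2 \<le> n" using k_pos k_less by simp
  define I where "I = (\<lambda>t. inv_into \<J> ?a (?a T - int t))"
  have area_mem: "?a T - int t \<in> ?a ` \<J>" if "t < n" for t unfolding areas using that by simp
  have I: "I t \<in> \<J>" "?a (I t) = ?a T - int t" if "t < n" for t
    using inv_into_into[OF area_mem[OF that]] f_inv_into_f[OF area_mem[OF that]]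
    unfolding I_def by auto
  have sub: "I t \<in> nsets {1..n} k" if "t < n" for t using I(1)[OF that] \<J>(1) by blast
  have \<J>_eq: "\<J> = I ` {..<n}"
  proof
    show "\<J> \<subseteq> I ` {..<n}"
    proof
      fix J assume J: "J \<in> \<J>"
      define t where "t = nat (?a T - ?a J)"
      have "?a J \<in> {?a T - int n + 1..?a T}" using J areas by blast
      then have "t < n" "?a J = ?a T - int t" by (auto simp: t_def)
      then show "J \<in> I ` {..<n}" using I[of t] inj_onD[OF inj, of J "I t"] J by auto
    qed
  qed (use I(1) in auto)
  have mono: "prefix_count (I t) x \<le> prefix_count (I s) x" "prefix_count (I s) x \<le> prefix_count (I t) x + 1"
    if "s \<le> t" "t < n" for s t x
  proof -
    have s: "s < n" using that by simp
    have srt: "sorted_sets (I t) (I s)" "sorted_sets (I s) (I t)"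
      using \<J>(2) I(1) that s by (auto simp: sorted_family_def)
    show "prefix_count (I s) x \<le> prefix_count (I t) x + 1"
      by (rule sorted_setsD(2)[OF srt(2) sub[OF s] sub[OF that(2)]])
    have "height_of (I t) (int (min x n)) \<le> height_of (I s) (int (min x n))"
      by (rule height_of_sorted(2)[OF srt(1) sub[OF that(2)] sub[OF s]]) (use I(2) that s in simp)
    then show "prefix_count (I t) x \<le> prefix_count (I s) x"
      using height_of_eq_prefix_count[OF sub[OF s], of "min x n"] height_of_eq_prefix_count[OF sub[OF that(2)], of "min x n"]
        prefix_count_full[OF sub[OF s], of x] prefix_count_full[OF sub[OF that(2)], of x]
      by (cases "x \<le> n") (auto simp: min_def)
  qed
  \<comment> \<open>The points that have dropped by time \<open>t\<close>.\<close>
  define U where "U = (\<lambda>t. {x \<in> {1..n - 1}. prefix_count (I t) x < prefix_count (I 0) x})"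
  have U_mono: "U s \<subseteq> U t" if "s \<le> t" "t < n" for s t
    using mono(1)[OF that] by (auto simp: U_def intro: le_less_trans)
  \<comment> \<open>The loss of area equals the number of lowered points.\<close>
  have card_U: "card (U t) = t" if t: "t < n" for t
  proof -
    have 0: "0 < n" using n by simp
    have "int t = ?a (I 0) - ?a (I t)" using I(2)[OF t] I(2)[OF 0] by simp
    also have "\<dots> = (\<Sum>x\<in>{1..n}. prefix_count (I 0) x - prefix_count (I t) x)"
      by (simp add: area_height_of[OF sub[OF t]] area_height_of[OF sub[OF 0]] sum_subtractf)
    also have "\<dots> = (\<Sum>x\<in>{1..n}. if x \<in> U t then 1 else 0)"
    proof (rule sum.cong[OF refl])
      fix x assume x: "x \<in> {1..n}"
      show "prefix_count (I 0) x - prefix_count (I t) x = (if x \<in> U t then 1 else 0)"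
      proof (cases "x = n")
        case True
        then show ?thesis
          using prefix_count_full[OF sub[OF t], of n] prefix_count_full[OF sub[OF 0], of n] n by (simp add: U_def)
      next
        case False
        then have "x \<in> {1..n - 1}" using x by auto
        then show ?thesis using mono[of 0 t x] t by (simp add: U_def)
      qed
    qed
    also have "\<dots> = int (card ({1..n} \<inter> U t))" by (simp add: sum.If_cases)
    also have "{1..n} \<inter> U t = U t" by (auto simp: U_def)
    finally show ?thesis by simp
  qed
  define v where "v = (\<lambda>x. if x \<in> {1..n - 1} then card {t. t < n \<and> x \<notin> U t} else x)"
  have v_le: "x \<in> U t \<longleftrightarrow> v x \<le> t" if x: "x \<in> {1..n - 1}" and t: "t < n" for x t
  proof
    assume "x \<in> U t"
    then have "{s. s < n \<and> x \<notin> U s} \<subseteq> {..<t}" using U_mono[of t] by (auto simp: not_less[symmetric])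
    then have "card {s. s < n \<and> x \<notin> U s} \<le> card {..<t}" by (intro card_mono) auto
    then show "v x \<le> t" using x by (simp add: v_def)
  next
    assume "v x \<le> t"
    show "x \<in> U t"
    proof (rule ccontr)
      assume "x \<notin> U t"
      then have "{..t} \<subseteq> {s. s < n \<and> x \<notin> U s}" using U_mono[of _ t] t by auto
      then have "card {..t} \<le> card {s. s < n \<and> x \<notin> U s}" by (intro card_mono) auto
      then show False using \<open>v x \<le> t\<close> x by (simp add: v_def)
    qed
  qed
  have "t \<in> v ` {1..n - 1}" if t: "t \<in> {1..n - 1}" for t
  proof -
    have tn: "t < n" "t - 1 < n" "t - 1 < t" using t by auto
    then have "U (t - 1) \<noteq> U t" using card_U[OF tn(1)] card_U[OF tn(2)] by auto
    then obtain x where "x \<in> U t" "x \<notin> U (t - 1)" using U_mono[of "t - 1" t] tn(1) by auto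
    moreover from this have x: "x \<in> {1..n - 1}" by (auto simp: U_def)
    ultimately have "v x \<le> t" "\<not> v x \<le> t - 1" using v_le[OF x] tn by auto
    then have "v x = t" by simp
    then show ?thesis using x by blast
  qed
  then have surj: "{1..n - 1} \<subseteq> v ` {1..n - 1}" by blast
  have "bij_betw v {1..n - 1} {1..n - 1}"
  proof -
    have inj_v: "inj_on v {1..n - 1}" by (rule finite_surj_inj[OF _ surj]) simp
    moreover have "card (v ` {1..n - 1}) = card {1..n - 1}" by (rule card_image[OF inj_v])
    ultimately show ?thesis using card_subset_eq[OF _ surj] by (auto simp: bij_betw_def)
  qed
  then have v: "v permutes {1..n - 1}" by (rule bij_imp_permutes) (auto simp: v_def)
  have vn: "v n = n" using n by (simp add: v_def)
  have pc: "prefix_count (I t) x = prefix_count (I 0) x - (if departure v x \<le> t then 1 else 0)"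
    if t: "t < n" and x: "x \<le> n" for t x
  proof -
    consider "x = 0" | "x \<in> {1..n - 1}" | "x = n" using x by (cases "x = 0"; cases "x = n") auto
    then show ?thesis
    proof cases
      case 2
      then show ?thesis using mono[of 0 t x] t v_le[OF 2 t] by (auto simp: departure_def U_def)
    next
      case 3
      then show ?thesis
        using prefix_count_full[OF sub[OF t], of n] prefix_count_full[OF sub[of 0], of n] n vn t
        by (simp add: departure_def)
    qed (use t in \<open>simp add: departure_def\<close>)
  qed
  have "x \<in> I 0 \<longleftrightarrow> departure v x < departure v (x - 1)" if x: "x \<in> {1..n}" for x
  proof -
    have bound: "departure v y \<le> n" if "y \<le> n" for y
    proof -
      consider "y = 0" | "y \<in> {1..n - 1}" | "y = n" using \<open>y \<le> n\<close>
        by (cases "y = 0"; cases "y = n") auto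
      then show ?thesis
      proof cases
        case 2
        then have "v y \<in> {1..n - 1}" using permutes_in_image[OF v, of y] by simp
        then show ?thesis by (auto simp: departure_def)
      qed (use vn in \<open>simp_all add: departure_def\<close>)
    qed
    have x1: "x - 1 \<le> n" using x by auto
    have ne: "departure v x \<noteq> departure v (x - 1)"
    proof (cases "x = 1")
      case True
      have "v 1 \<in> {1..n - 1}" using permutes_in_image[OF v, of 1] n by simp
      then show ?thesis using True by (auto simp: departure_def)
    next
      case False
      then have "v x \<noteq> v (x - 1)" using inj_eq[OF permutes_inj[OF v], of x "x - 1"] x by auto
      then show ?thesis using False x by (auto simp: departure_def)
    qed
    have step: "prefix_count J x = prefix_count J (x - 1) + (if x \<in> J then 1 else 0)" for J
      using prefix_count_Suc[of J "x - 1"] x by simp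
    show ?thesis
    proof (cases "departure v x < departure v (x - 1)")
      case True
      have "departure v (x - 1) \<le> n" by (rule bound[OF x1])
      then have t: "departure v x < n" using True by simp
      have "prefix_count (I (departure v x)) x = prefix_count (I 0) x - 1"
        "prefix_count (I (departure v x)) (x - 1) = prefix_count (I 0) (x - 1)"
        using pc[OF t, of x] pc[OF t x1] True x by simp_all
      then show ?thesis using step[of "I 0"] step[of "I (departure v x)"] True
        by (simp split: if_splits)
    next
      case False
      then have less: "departure v (x - 1) < departure v x" using ne by simp
      have "departure v x \<le> n" by (rule bound) (use x in auto)
      then have t: "departure v (x - 1) < n" using less by simp
      have "prefix_count (I (departure v (x - 1))) x = prefix_count (I 0) x"
        "prefix_count (I (departure v (x - 1))) (x - 1) = prefix_count (I 0) (x - 1) - 1"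
        using pc[OF t, of x] pc[OF t x1] less x by simp_all
      then show ?thesis using step[of "I 0"] step[of "I (departure v (x - 1))"] False
        by (simp split: if_splits)
    qed
  qed
  then have I0: "I 0 = descent_tops v"
    using sub[of 0] n by (auto simp: descent_tops_def nsets_def)
  have desc: "Suc (card (descents (n - 1) v)) = k"
    using card_descent_tops[OF v] sub[of 0] n by (simp add: I0 nsets_def)
  have "I t = chain_set v t" if t: "t < n" for t
    by (rule prefix_count_inject[OF sub[OF t] chain_set_in_nsets[OF v desc t]])
       (use pc[OF t] prefix_count_chain_set[OF t] I0 in simp)
  then have "\<J> = chain v" unfolding \<J>_eq chain_def by (intro image_cong) auto
  then show thesis using that v desc by blast
qed

lemma card_maximal_sorted_families:
  "card {\<J>. maximal_sorted_family n k \<J>} = eulerian_number (n - 1) (k - 1)"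
proof -
  define V where "V = {v. v permutes {1..n - 1} \<and> Suc (card (descents (n - 1) v)) = k}"
  have "{\<J>. maximal_sorted_family n k \<J>} = chain ` V"
    using maximal_sorted_family_chain maximal_sorted_family_eq_chain unfolding V_def by blast
  then have "card {\<J>. maximal_sorted_family n k \<J>} = card V"
    using card_image[OF inj_on_chain] unfolding V_def by simp
  also have "V = {v. v permutes {1..n - 1} \<and> card (descents (n - 1) v) = k - 1}"
    using k_pos by (auto simp: V_def)
  finally show ?thesis by (simp add: eulerian_number_def)
qed

end

section \<open>Arrangements of largest minors\<close>

lemma nsets_trivial:
  assumes "k = 0 \<or> k = n"
  obtains S where "nsets {1..n} k = {S}"
proof (cases "k = 0")
  case True
  then have "nsets {1..n} k = {{}}" by (auto simp: nsets_def)
  then show thesis by (rule that)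
next
  case False
  then have "k = n" using assms by simp
  have "nsets {1..n} k = {{1..n}}"
    using card_subset_eq[of "{1..n}"] \<open>k = n\<close> by (auto simp: nsets_def)
  then show thesis by (rule that)
qed

lemma largest_minors_arrangement_imp_sorted:
  assumes "k \<le> n" and arr: "largest_minors_arrangement k n \<J>"
  shows "sorted_family \<J>"
  unfolding sorted_family_def
proof (intro ballI)
  fix I J assume IJ: "I \<in> \<J>" "J \<in> \<J>"
  have sub: "\<J> \<subseteq> nsets {1..n} k" using arr by (simp add: largest_minors_arrangement_def)
  obtain p A where p: "p \<in> Gr_pos k n" and A: "A \<in> positive_reps k n p"
    and eq: "\<And>I J. I \<in> \<J> \<Longrightarrow> J \<in> \<J> \<Longrightarrow> plucker A I = plucker A J"
    and less: "\<And>I K. I \<in> \<J> \<Longrightarrow> K \<in> nsets {1..n} k - \<J> \<Longrightarrow> plucker A K < plucker A I"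
    using arr unfolding largest_minors_arrangement_def by blast
  show "sorted_sets I J"
  proof (cases "k = 0 \<or> k = n")
    case True
    then obtain S where "nsets {1..n} k = {S}" by (rule nsets_trivial)
    then have "I = J" "finite I" using IJ sub by (auto simp: nsets_def)
    then show ?thesis using sorted_sets_refl by blast
  next
    case False
    then interpret height_functions n k by unfold_locales (use assms in auto)
    have "A \<in> carrier_mat k n"
      using p A by (auto simp: Gr_pos_def Gr_def positive_reps_def quotient_def row_equivalence_def full_rank_mats_def)
    moreover have pos: "0 < plucker A K" if "K \<in> nsets {1..n} k" for K
      using A that by (simp add: positive_reps_def)
    ultimately have crossing: "crossing_supermodular n k (\<lambda>I. ln (plucker A I))"
      by (rule crossing_supermodular_ln_plucker)
    show ?thesis
    proof (rule maximizers_sorted[OF crossing])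
      show "I \<in> nsets {1..n} k" "J \<in> nsets {1..n} k" using IJ sub by auto
      show "ln (plucker A J) = ln (plucker A I)" using eq[OF IJ] by simp
      fix K assume K: "K \<in> nsets {1..n} k"
      have "plucker A K \<le> plucker A I"
        using eq[of K I] less[OF IJ(1), of K] IJ(1) K by (cases "K \<in> \<J>") auto
      then show "ln (plucker A K) \<le> ln (plucker A I)" using pos[OF K] by simp
    qed
  qed
qed

lemma sorted_imp_largest_minors_arrangement:
  assumes "k \<le> n" and \<J>: "\<J> \<noteq> {}" "\<J> \<subseteq> nsets {1..n} k" "sorted_family \<J>"
  shows "largest_minors_arrangement k n \<J>"
proof -
  obtain t C where
    top: "\<And>I. I \<in> \<J> \<Longrightarrow> ln (plucker (scaled_vandermonde k n t) I) = C"
    and less: "\<And>K. K \<in> nsets {1..n} k - \<J> \<Longrightarrow> ln (plucker (scaled_vandermonde k n t) K) < C"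
    using sorted_family_selected_by_scaling[OF \<J>(2,1,3)] by blast
  define V where "V = scaled_vandermonde k n t"
  define p where "p = row_equivalence k n `` {V}"
  have V: "V \<in> full_rank_mats k n" unfolding V_def by (rule scaled_vandermonde_full_rank[OF assms(1)])
  have "V \<in> carrier_mat k n" using V by (simp add: full_rank_mats_def)
  then have "V = 1\<^sub>m k * V" by simp
  moreover have "invertible_mat (1\<^sub>m k :: real mat)"
    unfolding invertible_mat_def inverts_mat_def by (auto intro!: exI[of _ "1\<^sub>m k"])
  ultimately have "V \<in> p"
    using V unfolding p_def row_equivalence_def by (auto intro!: bexI[of _ "1\<^sub>m k"])
  have pos: "0 < plucker V I" if "I \<in> nsets {1..n} k" for I
    unfolding V_def plucker_scaled_vandermonde[OF that]
    by (auto intro!: mult_pos_pos prod_pos)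
  then have reps: "V \<in> positive_reps k n p" using \<open>V \<in> p\<close> by (simp add: positive_reps_def)
  moreover have "p \<in> Gr k n" unfolding p_def Gr_def by (rule quotientI[OF V])
  ultimately have "p \<in> Gr_pos k n" by (auto simp: Gr_pos_def)
  moreover have "plucker V I = plucker V J" if "I \<in> \<J>" "J \<in> \<J>" for I J
  proof -
    have "0 < plucker V I" "0 < plucker V J" using pos that \<J>(2) by blast+
    moreover have "ln (plucker V I) = ln (plucker V J)"
      using top[OF that(1)] top[OF that(2)] unfolding V_def by simp
    ultimately show ?thesis by (simp only: ln_inj_iff)
  qed
  moreover have "plucker V K < plucker V I" if "I \<in> \<J>" "K \<in> nsets {1..n} k - \<J>" for I K
  proof -
    have "0 < plucker V I" "0 < plucker V K" using pos that \<J>(2) by blast+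
    moreover have "ln (plucker V K) < ln (plucker V I)"
      using top[OF that(1)] less[OF that(2)] unfolding V_def by simp
    ultimately show ?thesis by (simp only: ln_less_cancel_iff)
  qed
  ultimately show ?thesis
    using \<J>(1,2) reps unfolding largest_minors_arrangement_def by blast
qed

lemma largest_minors_arrangement_iff:
  assumes "k \<le> n"
  shows "largest_minors_arrangement k n \<J> \<longleftrightarrow> \<J> \<noteq> {} \<and> \<J> \<subseteq> nsets {1..n} k \<and> sorted_family \<J>"
proof
  assume arr: "largest_minors_arrangement k n \<J>"
  then show "\<J> \<noteq> {} \<and> \<J> \<subseteq> nsets {1..n} k \<and> sorted_family \<J>"
    using largest_minors_arrangement_imp_sorted[OF assms arr]
    by (simp add: largest_minors_arrangement_def)
qed (use sorted_imp_largest_minors_arrangement[OF assms] in blast)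

lemma maximal_largest_minors_arrangement_iff:
  assumes "k \<le> n"
  shows "maximal_largest_minors_arrangement k n \<J> \<longleftrightarrow> maximal_sorted_family n k \<J>"
  unfolding maximal_largest_minors_arrangement_def maximal_sorted_family_def
    largest_minors_arrangement_iff[OF assms]
  by blast

lemma maximal_sorted_family_trivial:
  assumes "nsets {1..n} k = {S}"
  shows "maximal_sorted_family n k \<J> \<longleftrightarrow> \<J> = {S}"
proof -
  have "finite S" using assms by (auto simp: nsets_def)
  then have "sorted_family {S}" by (simp add: sorted_family_def sorted_sets_refl)
  then show ?thesis unfolding maximal_sorted_family_def assms subset_singleton_iff by auto
qed

lemma eulerian_number_0: "eulerian_number 0 0 = 1"
  by (simp add: eulerian_number_def descents_def)

theorem theorem5p4:
  fixes k n :: nat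
  assumes "k \<le> n"
  shows
    "(\<forall>\<J>. \<J> \<noteq> {} \<and> \<J> \<subseteq> nsets {1..n} k \<longrightarrow>
        (largest_minors_arrangement k n \<J> \<longleftrightarrow> sorted_family \<J>)) \<and>
     (0 < k \<and> k < n \<or> n = 1 \<longrightarrow>
        (\<forall>\<J>. maximal_largest_minors_arrangement k n \<J> \<longrightarrow> card \<J> = n)) \<and>
     (0 < k \<and> (k < n \<or> n = 1) \<longrightarrow>
        card {\<J>. maximal_largest_minors_arrangement k n \<J>} = eulerian_number (n - 1) (k - 1))"
proof (intro conjI impI allI)
  fix \<J> assume "\<J> \<noteq> {} \<and> \<J> \<subseteq> nsets {1..n} k"
  then show "largest_minors_arrangement k n \<J> \<longleftrightarrow> sorted_family \<J>"
    by (simp add: largest_minors_arrangement_iff[OF assms])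
next
  fix \<J> assume nk: "0 < k \<and> k < n \<or> n = 1" and "maximal_largest_minors_arrangement k n \<J>"
  then have max: "maximal_sorted_family n k \<J>"
    by (simp add: maximal_largest_minors_arrangement_iff[OF assms])
  show "card \<J> = n"
  proof (cases "0 < k \<and> k < n")
    case True
    then interpret height_functions n k by unfold_locales auto
    show ?thesis by (rule card_maximal_sorted_family[OF max])
  next
    case False
    then have n: "n = 1" "k = 0 \<or> k = n" using nk assms by auto
    obtain S where "nsets {1..n} k = {S}" using n(2) by (rule nsets_trivial)
    then show ?thesis using max maximal_sorted_family_trivial[of n k S] n(1) by simp
  qed
next
  assume nk: "0 < k \<and> (k < n \<or> n = 1)"
  show "card {\<J>. maximal_largest_minors_arrangement k n \<J>} = eulerian_number (n - 1) (k - 1)"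
    unfolding maximal_largest_minors_arrangement_iff[OF assms]
  proof (cases "k < n")
    case True
    then interpret height_functions n k by unfold_locales (use nk in auto)
    show "card {\<J>. maximal_sorted_family n k \<J>} = eulerian_number (n - 1) (k - 1)"
      by (rule card_maximal_sorted_families)
  next
    case False
    then have n: "n = 1" "k = 1" using nk assms by auto
    obtain S where "nsets {1..n} k = {S}" using n by (metis nsets_trivial)
    then show "card {\<J>. maximal_sorted_family n k \<J>} = eulerian_number (n - 1) (k - 1)"
      using n by (simp add: maximal_sorted_family_trivial eulerian_number_0)
  qed
qed

end
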